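(* Let $(M,g)$ be a smooth compact connected Riemannian manifold of dimension $n\geq2$ with boundary, and let $\alpha\in(0,1)$. Let $a\in\mathcal{C}^2(M\times\mathbb{R})$ satisfy $a(x,0)=0$ for all $x\in M$ and $\partial_\mu a(x,\mu)\geq0$ for all $(x,\mu)\in M\times\mathbb{R}$. Let $f\in C^{2+\alpha}(\partial M)$ satisfy $$\inf_{x\in\partial M}f(x)=c>0,$$ and let $(h_\mu)_{\mu\in\mathbb{R}}$ be a family of elements $h_\mu\in C^{2+\alpha}(\partial M)$. Then, for any $\mu_1>0$, the condition $$\Lambda_a(\mu f)=\Lambda_0(h_\mu),\qquad \mu\in(-\mu_1,\mu_1)$$ implies $$a(x,\mu)=0,\qquad (x,\mu)\in M\times(-c\mu_1,c\mu_1),$$ and, for any $x_0\in\partial M$, $$h_\mu(x)=h_\mu(x_0)+\mu\,(f(x)-f(x_0)),\qquad (x,\mu)\in\partial M\times(-\mu_1,\mu_1).$$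
   Context: $\Delta_g$ is the Laplace–Beltrami operator and $C^{2+\alpha}$ denotes the Hölder space $C^{2,\alpha}$. For $a\in\mathcal{C}^2(M\times\mathbb{R})$ with $a(x,0)=0$ and $\partial_\mu a(x,\mu)\geq0$, for every $f\in C^{2+\alpha}(\partial M)$ the problem $-\Delta_g u+a(x,u)=0$ in $M$, $u=f$ on $\partial M$, has a unique solution $u\in C^{2+\alpha}(M)$. The Dirichlet-to-Neumann map is $\Lambda_a(f)=\partial_\nu u|_{\partial M}$, where $\nu$ is the exterior unit normal vector field on $\partial M$. $\Lambda_0$ is the Dirichlet-to-Neumann map for $a\equiv0$. *)

theory Defs
  imports "HOL-Analysis.Analysis"
begin

section \<open>Classes of differentiable functions up to the boundary\<close>

text \<open>
  All derivatives are taken within \<open>S\<close>.  On a relatively open subset of a closed half-space they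
  are unique and one-sided at boundary points.  On a relatively open subset of a coordinate
  hyperplane the derivative in the normal direction is not determined by \<open>f\<close>; as the family
  \<open>f'\<close> is existentially quantified it may be taken to be \<open>0\<close> there, so that the classes below are
  the usual ones for functions of the tangential coordinates.
\<close>

primrec iterated_diff ::
  "('d::euclidean_space set \<Rightarrow> ('d \<Rightarrow> 'b::real_normed_vector) \<Rightarrow> bool) \<Rightarrow> 'd set \<Rightarrow> nat \<Rightarrow> ('d \<Rightarrow> 'b) \<Rightarrow> bool"
where
  "iterated_diff P S 0 f \<longleftrightarrow> P S f"
| "iterated_diff P S (Suc k) f \<longleftrightarrow>
     (\<exists>f'. (\<forall>x\<in>S. (f has_derivative f' x) (at x within S)) \<and>
           (\<forall>i\<in>Basis. iterated_diff P S k (\<lambda>x. f' x i)))"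

definition Ck_on :: "nat \<Rightarrow> 'd::euclidean_space set \<Rightarrow> ('d \<Rightarrow> 'b::real_normed_vector) \<Rightarrow> bool"
  where "Ck_on k S f \<longleftrightarrow> iterated_diff continuous_on S k f"

definition smooth_on :: "'d::euclidean_space set \<Rightarrow> ('d \<Rightarrow> 'b::real_normed_vector) \<Rightarrow> bool"
  where "smooth_on S f \<longleftrightarrow> (\<forall>k. Ck_on k S f)"

definition locally_Holder_on ::
  "real \<Rightarrow> 'd::euclidean_space set \<Rightarrow> ('d \<Rightarrow> 'b::real_normed_vector) \<Rightarrow> bool"
  where "locally_Holder_on \<alpha> S f \<longleftrightarrow>
    (\<forall>x\<in>S. \<exists>e>0. \<exists>C. \<forall>y\<in>S \<inter> ball x e. \<forall>z\<in>S \<inter> ball x e. norm (f y - f z) \<le> C * dist y z powr \<alpha>)"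

definition Ck_Holder_on ::
  "nat \<Rightarrow> real \<Rightarrow> 'd::euclidean_space set \<Rightarrow> ('d \<Rightarrow> 'b::real_normed_vector) \<Rightarrow> bool"
  where "Ck_Holder_on k \<alpha> S f \<longleftrightarrow> iterated_diff (locally_Holder_on \<alpha>) S k f"


section \<open>Riemannian manifolds with boundary\<close>

text \<open>The coordinate that defines the model half-space; which one is chosen is immaterial.\<close>

definition bdry_coord :: "'n::finite"
  where "bdry_coord = (SOME k. True)"

definition half_space :: "(real ^ 'n) set"
  where "half_space = {y. 0 \<le> y $ bdry_coord}"

type_synonym ('a, 'n) chart = "'a set \<times> ('a \<Rightarrow> real ^ 'n)"

abbreviation chart_image :: "('a, 'n::finite) chart \<Rightarrow> (real ^ 'n) set"
  where "chart_image c \<equiv> snd c ` fst c"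

abbreviation chart_inv :: "('a, 'n::finite) chart \<Rightarrow> real ^ 'n \<Rightarrow> 'a"
  where "chart_inv c \<equiv> inv_into (fst c) (snd c)"

text \<open>The metric is given by its component matrices: \<open>metric M c p $ i $ j\<close> is
  \<open>g\<^sub>p(\<partial>\<^sub>i, \<partial>\<^sub>j)\<close> for the coordinate vector fields of the chart \<open>c\<close>.\<close>

record ('a, 'n) riem =
  points :: "'a set"
  charts :: "('a, 'n) chart set"
  metric :: "('a, 'n) chart \<Rightarrow> 'a \<Rightarrow> real ^ 'n ^ 'n"

locale riemannian_manifold_with_boundary =
  fixes M :: "('a::t2_space, 'n::finite) riem"
  assumes second_countable: "second_countable (top_of_set (points M))"
    and charts_cover: "(\<Union>c\<in>charts M. fst c) = points M"
    and chart_dom_open: "c \<in> charts M \<Longrightarrow> openin (top_of_set (points M)) (fst c)"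
    and chart_image_open: "c \<in> charts M \<Longrightarrow> openin (top_of_set half_space) (chart_image c)"
    and chart_homeo: "c \<in> charts M \<Longrightarrow> homeomorphism (fst c) (chart_image c) (snd c) (chart_inv c)"
    and transition_smooth:
      "c \<in> charts M \<Longrightarrow> d \<in> charts M \<Longrightarrow> smooth_on (snd c ` (fst c \<inter> fst d)) (snd d \<circ> chart_inv c)"
    and metric_smooth: "c \<in> charts M \<Longrightarrow> smooth_on (chart_image c) (metric M c \<circ> chart_inv c)"
    and metric_sym: "c \<in> charts M \<Longrightarrow> p \<in> fst c \<Longrightarrow> transpose (metric M c p) = metric M c p"
    and metric_pos: "c \<in> charts M \<Longrightarrow> p \<in> fst c \<Longrightarrow> v \<noteq> 0 \<Longrightarrow> 0 < v \<bullet> (metric M c p *v v)"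
    and metric_transform:
      "c \<in> charts M \<Longrightarrow> d \<in> charts M \<Longrightarrow> p \<in> fst c \<inter> fst d \<Longrightarrow>
       J = jacobian (snd d \<circ> chart_inv c) (at (snd c p) within snd c ` (fst c \<inter> fst d)) \<Longrightarrow>
       metric M c p = transpose J ** metric M d p ** J"

definition boundary :: "('a, 'n::finite) riem \<Rightarrow> 'a set"
  where "boundary M = {p. \<exists>c\<in>charts M. p \<in> fst c \<and> snd c p $ bdry_coord = 0}"


section \<open>Function spaces on a manifold\<close>

definition Holder_space :: "('a, 'n::finite) riem \<Rightarrow> nat \<Rightarrow> real \<Rightarrow> ('a \<Rightarrow> real) set"
  where "Holder_space M k \<alpha> =
    {u. \<forall>c\<in>charts M. Ck_Holder_on k \<alpha> (chart_image c) (u \<circ> chart_inv c)}"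

definition Holder_space_boundary :: "('a, 'n::finite) riem \<Rightarrow> nat \<Rightarrow> real \<Rightarrow> ('a \<Rightarrow> real) set"
  where "Holder_space_boundary M k \<alpha> =
    {f. \<forall>c\<in>charts M. Ck_Holder_on k \<alpha> (snd c ` (fst c \<inter> boundary M)) (f \<circ> chart_inv c)}"

definition Ck_space_times_real :: "('a, 'n::finite) riem \<Rightarrow> nat \<Rightarrow> ('a \<Rightarrow> real \<Rightarrow> real) set"
  where "Ck_space_times_real M k =
    {a. \<forall>c\<in>charts M. Ck_on k (chart_image c \<times> UNIV) (\<lambda>(y, s). a (chart_inv c y) s)}"


section \<open>Laplace--Beltrami operator and Dirichlet-to-Neumann map\<close>

definition partial_deriv :: "(real ^ 'n::finite) set \<Rightarrow> 'n \<Rightarrow> (real ^ 'n \<Rightarrow> real) \<Rightarrow> real ^ 'n \<Rightarrow> real"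
  where "partial_deriv S i F y = frechet_derivative F (at y within S) (axis i 1)"

text \<open>\<open>\<Delta>\<^sub>g u = |g|\<^sup>-\<^sup>1\<^sup>/\<^sup>2 \<Sum>\<^sub>i\<^sub>j \<partial>\<^sub>i (|g|\<^sup>1\<^sup>/\<^sup>2 g\<^sup>i\<^sup>j \<partial>\<^sub>j u)\<close>, evaluated in the chart \<open>c\<close>; the value at \<open>p\<close> is the
  same for all charts around \<open>p\<close>.\<close>

definition laplace_beltrami ::
  "('a, 'n::finite) riem \<Rightarrow> ('a, 'n) chart \<Rightarrow> ('a \<Rightarrow> real) \<Rightarrow> 'a \<Rightarrow> real"
  where "laplace_beltrami M c u p =
    (let S = chart_image c; G = metric M c \<circ> chart_inv c in
      (\<Sum>i\<in>UNIV. \<Sum>j\<in>UNIV.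
         partial_deriv S i
           (\<lambda>y. sqrt (det (G y)) * matrix_inv (G y) $ i $ j * partial_deriv S j (u \<circ> chart_inv c) y)
           (snd c p))
      / sqrt (det (metric M c p)))"

text \<open>Components in the chart \<open>c\<close> of the exterior unit normal at a boundary point \<open>p\<close>.
  Tangent vectors of the boundary have vanishing \<open>bdry_coord\<close> component.\<close>

definition exterior_unit_normal ::
  "('a, 'n::finite) riem \<Rightarrow> ('a, 'n) chart \<Rightarrow> 'a \<Rightarrow> real ^ 'n"
  where "exterior_unit_normal M c p =
    (THE N. N \<bullet> (metric M c p *v N) = 1 \<and>
            (\<forall>v. v $ bdry_coord = 0 \<longrightarrow> N \<bullet> (metric M c p *v v) = 0) \<and>
            N $ bdry_coord < 0)"

text \<open>\<open>\<partial>\<^sub>\<nu> u\<close>; the value does not depend on the chart that is selected around \<open>p\<close>.\<close>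

definition normal_deriv :: "('a, 'n::finite) riem \<Rightarrow> ('a \<Rightarrow> real) \<Rightarrow> 'a \<Rightarrow> real"
  where "normal_deriv M u p =
    (let c = (SOME c. c \<in> charts M \<and> p \<in> fst c) in
      frechet_derivative (u \<circ> chart_inv c) (at (snd c p) within chart_image c)
        (exterior_unit_normal M c p))"

text \<open>Classical solutions of \<open>-\<Delta>\<^sub>g u + a(x,u) = 0\<close> in \<open>M\<close>, \<open>u = f\<close> on the boundary.
  Extensionality outside \<open>M\<close> makes uniqueness a statement about functions on \<open>M\<close>.\<close>

definition dirichlet_solution ::
  "('a, 'n::finite) riem \<Rightarrow> real \<Rightarrow> ('a \<Rightarrow> real \<Rightarrow> real) \<Rightarrow> ('a \<Rightarrow> real) \<Rightarrow> ('a \<Rightarrow> real) \<Rightarrow> bool"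
  where "dirichlet_solution M \<alpha> a f u \<longleftrightarrow>
    u \<in> extensional (points M) \<and> u \<in> Holder_space M 2 \<alpha> \<and>
    (\<forall>c\<in>charts M. \<forall>x\<in>fst c. - laplace_beltrami M c u x + a x (u x) = 0) \<and>
    (\<forall>x\<in>boundary M. u x = f x)"

text \<open>The Dirichlet-to-Neumann map as a partial map into functions on the boundary, defined at \<open>f\<close>
  iff the Dirichlet problem has exactly one solution.\<close>

definition dn_map ::
  "('a, 'n::finite) riem \<Rightarrow> real \<Rightarrow> ('a \<Rightarrow> real \<Rightarrow> real) \<Rightarrow> ('a \<Rightarrow> real) \<rightharpoonup> ('a \<Rightarrow> real)"
  where "dn_map M \<alpha> a f =
    (if \<exists>!u. dirichlet_solution M \<alpha> a f u
     then Some (restrict (normal_deriv M (THE u. dirichlet_solution M \<alpha> a f u)) (boundary M))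
     else None)"

end

theory Submission
  imports Defs
begin

text \<open>
  No integration is needed.  Let \<open>u\<close> solve the nonlinear problem with data \<open>\<mu> f\<close>, let \<open>v\<close> be harmonic
  with data \<open>h\<^sub>\<mu>\<close>, and let \<open>\<sigma>\<close> be the sign of \<open>\<mu>\<close>.  The minimum principle gives \<open>0 \<le> \<sigma> u\<close>, so
  \<open>w = \<sigma> (u - v)\<close> satisfies \<open>\<Delta> w = \<sigma> a(x, u) \<ge> 0\<close> with vanishing normal derivative.  By Hopf's lemma
  and the strong maximum principle \<open>w\<close> is constant; this is the formula for \<open>h\<^sub>\<mu>\<close>, and it gives
  \<open>a(x, u(x)) = 0\<close>.  Hence \<open>u\<close> is harmonic and \<open>\<sigma> u \<ge> \<bar>\<mu>\<bar> c\<close>, and monotonicity of \<open>a(x, \<cdot>)\<close>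
  makes \<open>a(x, s)\<close> vanish for all \<open>s\<close> between \<open>0\<close> and \<open>\<mu> c\<close>.
\<close>

text \<open>The vanishing normal derivative serves to treat boundary points like interior ones. If
  \<open>w\<close> touched its maximum at a boundary point while staying strictly below it inside,
  Hopf's lemma would give a strictly positive outward derivative there. So the set where
  \<open>w\<close> is maximal is open as well as closed in the connected \<open>M\<close>, boundary
  included.

  The nonlinearity is only used through its sign, as a right-hand side; nothing is linearized in
  \<mu>. This shapes the order of the steps. Where \<sigma> u lies between 0 and |\<mu>| c, the
  function \<sigma> u is subharmonic, which is the wrong direction for a lower bound. The minimum
  principle therefore runs first with threshold 0, where only the region \<sigma> u < 0 matters, and
  with threshold |\<mu>| c only once a(x, u(x)) = 0 is known.

  The analysis takes place in half-space charts, for operators in nondivergence form with continuous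
  coefficients. The boundary is flat there, so a ball touching it from inside is always available.
  The metric enters only when the Laplacian is brought into this form.\<close>

section \<open>Second-order conditions at a maximum\<close>

text \<open>Induction on the index set, splitting \<open>a\<close> into a Schur complement, which is
  again positive definite, and a rank-one matrix whose contraction with \<open>b\<close> is a value
  of the quadratic form of \<open>b\<close>. Only that form is constrained, since \<open>b\<close>
  will be minus a matrix of second derivatives, for which symmetry would be a separate
  argument.\<close>

lemma pos_def_contraction_nonneg:
  fixes a b :: "'i \<Rightarrow> 'i \<Rightarrow> real"
  assumes "finite I"
    and "\<And>i j. i \<in> I \<Longrightarrow> j \<in> I \<Longrightarrow> a i j = a j i"
    and "\<And>x. \<exists>i\<in>I. x i \<noteq> 0 \<Longrightarrow> 0 < (\<Sum>i\<in>I. \<Sum>j\<in>I. a i j * x i * x j)"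
    and "\<And>x. 0 \<le> (\<Sum>i\<in>I. \<Sum>j\<in>I. b i j * x i * x j)"
  shows "0 \<le> (\<Sum>i\<in>I. \<Sum>j\<in>I. a i j * b i j)"
  using assms
proof (induction I arbitrary: a rule: finite_induct)
  case empty
  then show ?case by simp
next
  case (insert k I)
  let ?K = "insert k I"
  have akk: "0 < a k k"
  proof -
    have "0 < (\<Sum>i\<in>?K. \<Sum>j\<in>?K. a i j * of_bool (i = k) * of_bool (j = k))"
      by (rule insert.prems(2)) auto
    also have "\<dots> = (\<Sum>i\<in>?K. if i = k then a k k else 0)"
      using insert.hyps by (intro sum.cong refl) (auto simp: of_bool_def if_distrib cong: if_cong)
    also have "\<dots> = a k k"
      using insert.hyps by (subst sum.delta) auto
    finally show ?thesis .
  qed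
  \<comment> \<open>The Schur complement of the entry \<open>a k k\<close>, extended by zero to row and column \<open>k\<close>.\<close>
  define s where "s = (\<lambda>i j. a i j - a i k * a j k / a k k)"
  have s0: "s i k = 0" "s k i = 0" if "i \<in> ?K" for i
    using akk insert.prems(1)[of k i] that by (auto simp: s_def)
  have drop_k: "(\<Sum>i\<in>?K. \<Sum>j\<in>?K. s i j * t i j) = (\<Sum>i\<in>I. \<Sum>j\<in>I. s i j * t i j)" for t
    using insert.hyps s0 by (simp)
  \<comment> \<open>Stated for every \<open>t\<close> because it is applied twice: to
    \<open>b\<close>, and to the products \<open>y i * y j\<close> that prove the Schur complement
    positive.\<close>
  have split: "(\<Sum>i\<in>?K. \<Sum>j\<in>?K. a i j * t i j) =
      (\<Sum>i\<in>I. \<Sum>j\<in>I. s i j * t i j) + (\<Sum>i\<in>?K. \<Sum>j\<in>?K. a i k * a j k * t i j) / a k k" for t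
    unfolding drop_k[symmetric] sum_divide_distrib sum.distrib[symmetric]
    by (intro sum.cong refl) (simp add: s_def algebra_simps)
  have "0 \<le> (\<Sum>i\<in>I. \<Sum>j\<in>I. s i j * b i j)"
  proof (rule insert.IH)
    show "s i j = s j i" if "i \<in> I" "j \<in> I" for i j
      using that insert.prems(1) by (simp add: s_def)
  next
    fix x :: "'i \<Rightarrow> real" assume x: "\<exists>i\<in>I. x i \<noteq> 0"
    \<comment> \<open>Completing the square: this value at \<open>k\<close> makes \<open>y\<close>
      orthogonal to column \<open>k\<close> of \<open>a\<close>, so the rank-one part vanishes and
      the form of \<open>s\<close> at \<open>x\<close> equals the form of \<open>a\<close> at
      \<open>y\<close>.\<close>
    define y where "y = x(k := - (\<Sum>i\<in>I. a i k * x i) / a k k)"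
    have yI: "y i = x i" if "i \<in> I" for i
      using that insert.hyps by (auto simp: y_def)
    have "(\<Sum>i\<in>?K. a i k * y i) = 0"
      using insert.hyps akk yI by (simp add: y_def)
    then have z: "(\<Sum>i\<in>?K. \<Sum>j\<in>?K. a i k * a j k * (y i * y j)) = 0"
    proof -
      have "(\<Sum>i\<in>?K. \<Sum>j\<in>?K. a i k * a j k * (y i * y j))
          = (\<Sum>i\<in>?K. a i k * y i) * (\<Sum>j\<in>?K. a j k * y j)"
        unfolding sum_product by (intro sum.cong refl) (simp add: algebra_simps)
      with \<open>(\<Sum>i\<in>?K. a i k * y i) = 0\<close> show ?thesis by simp
    qed
    have "0 < (\<Sum>i\<in>?K. \<Sum>j\<in>?K. a i j * y i * y j)"
      using x yI by (intro insert.prems(2)) auto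
    also have "\<dots> = (\<Sum>i\<in>?K. \<Sum>j\<in>?K. a i j * (y i * y j))"
      by (simp add: mult.assoc)
    also have "\<dots> = (\<Sum>i\<in>I. \<Sum>j\<in>I. s i j * x i * x j)"
      unfolding split z using yI by (simp add: mult.assoc)
    finally show "0 < (\<Sum>i\<in>I. \<Sum>j\<in>I. s i j * x i * x j)" .
  next
    fix x :: "'i \<Rightarrow> real"
    have "0 \<le> (\<Sum>i\<in>?K. \<Sum>j\<in>?K. b i j * (x(k := 0)) i * (x(k := 0)) j)"
      by (rule insert.prems(3))
    also have "\<dots> = (\<Sum>i\<in>I. \<Sum>j\<in>I. b i j * (x(k := 0)) i * (x(k := 0)) j)"
      using insert.hyps by simp
    also have "\<dots> = (\<Sum>i\<in>I. \<Sum>j\<in>I. b i j * x i * x j)"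
      using insert.hyps by (intro sum.cong refl) auto
    finally show "0 \<le> (\<Sum>i\<in>I. \<Sum>j\<in>I. b i j * x i * x j)" .
  qed
  moreover have "0 \<le> (\<Sum>i\<in>?K. \<Sum>j\<in>?K. a i k * a j k * b i j)"
    using insert.prems(3)[of "\<lambda>i. a i k"] by (simp add: algebra_simps)
  ultimately show ?case
    unfolding split using akk by simp
qed

text \<open>A positive \<open>l\<close> would make \<open>g'\<close> positive immediately to the
  right of its zero, and the mean value theorem would then produce a value above the
  maximum.\<close>

lemma second_derivative_test_real:
  fixes g g' :: "real \<Rightarrow> real"
  assumes "0 < e"
    and g': "\<And>t. \<bar>t\<bar> < e \<Longrightarrow> (g has_real_derivative g' t) (at t)"
    and l: "(g' has_real_derivative l) (at 0)" and max: "\<And>t. \<bar>t\<bar> < e \<Longrightarrow> g t \<le> g 0"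
  shows "g' 0 = 0" and "l \<le> 0"
proof -
  show g0: "g' 0 = 0"
    using g'[of 0] DERIV_local_max[of g "g' 0" 0 e] max \<open>0 < e\<close> by auto
  show "l \<le> 0"
  proof (rule ccontr)
    assume "\<not> l \<le> 0"
    then obtain d where d: "0 < d" "\<And>h. 0 < h \<Longrightarrow> h < d \<Longrightarrow> g' 0 < g' (0 + h)"
      using DERIV_pos_inc_right[OF l] by auto
    define t where "t = min d e / 2"
    have t: "0 < t" "t < d" "t < e"
      using d \<open>0 < e\<close> by (auto simp: t_def)
    have "\<exists>z. 0 < z \<and> z < t \<and> g t - g 0 = (t - 0) * g' z"
      using t by (intro MVT2 g') auto
    then obtain z where "0 < z" "z < t" "g t - g 0 = t * g' z" by auto
    moreover have "0 < g' z"
      using d(2)[of z] g0 \<open>0 < z\<close> \<open>z < t\<close> t by auto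
    ultimately have "g t > g 0"
      using t by (smt (verit) mult_pos_pos)
    with max[of t] t show False by auto
  qed
qed

lemma linear_axis_expand:
  fixes D :: "real ^ 'n \<Rightarrow> real"
  assumes "linear D"
  shows "D v = (\<Sum>i\<in>UNIV. v $ i * D (axis i 1))"
proof -
  have "D v = D (\<Sum>i\<in>UNIV. v $ i *\<^sub>R axis i 1)"
    by (simp add: basis_expansion scalar_mult_eq_scaleR[symmetric])
  also have "\<dots> = (\<Sum>i\<in>UNIV. v $ i * D (axis i 1))"
    using assms by (simp add: linear_sum linear_cmul)
  finally show ?thesis .
qed

text \<open>Restriction to the line through \<open>x\<close> in direction \<open>v\<close>. Along it
  the first derivative is a combination of coordinate partials, so the derivatives
  \<open>w'' j\<close> at the single point \<open>x\<close> give the second derivative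
  there.\<close>

lemma second_derivative_test:
  fixes w :: "real ^ 'n \<Rightarrow> real"
  assumes T: "open T" "x \<in> T"
    and w': "\<And>y. y \<in> T \<Longrightarrow> (w has_derivative w' y) (at y)"
    and w'': "\<And>j. ((\<lambda>y. w' y (axis j 1)) has_derivative w'' j) (at x)"
    and max: "\<And>y. y \<in> T \<Longrightarrow> w y \<le> w x"
  shows "w' x v = 0" and "(\<Sum>i\<in>UNIV. \<Sum>j\<in>UNIV. w'' j (axis i 1) * v $ i * v $ j) \<le> 0"
proof -
  obtain r where r: "0 < r" "ball x r \<subseteq> T"
    using T openE by blast
  \<comment> \<open>The summand 1 covers \<open>v = 0\<close>.\<close>
  define e where "e = r / (norm v + 1)"
  have e: "0 < e"
    using r by (auto simp: e_def intro!: divide_pos_pos add_nonneg_pos)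
  have inT: "x + t *\<^sub>R v \<in> T" if "\<bar>t\<bar> < e" for t
  proof -
    have "\<bar>t\<bar> * norm v \<le> \<bar>t\<bar> * (norm v + 1)"
      by (intro mult_left_mono) auto
    also have "\<dots> < r"
      using that unfolding e_def by (subst (asm) pos_less_divide_eq) (auto intro: add_nonneg_pos)
    finally show ?thesis
      using r by (auto simp: dist_norm subset_iff)
  qed
  define g where "g = (\<lambda>t. w (x + t *\<^sub>R v))"
  define g' where "g' = (\<lambda>t. w' (x + t *\<^sub>R v) v)"
  have g': "(g has_real_derivative g' t) (at t)" if "\<bar>t\<bar> < e" for t
  proof -
    note d = w'[OF inT[OF that]]
    have "(g has_derivative (\<lambda>s. w' (x + t *\<^sub>R v) (s *\<^sub>R v))) (at t)"
      unfolding g_def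
      by (rule has_derivative_compose[where f = "\<lambda>t. x + t *\<^sub>R v", OF _ d])
        (auto intro!: derivative_eq_intros)
    moreover have "(\<lambda>s. w' (x + t *\<^sub>R v) (s *\<^sub>R v)) = (*) (g' t)"
      using linear_cmul[OF has_derivative_linear[OF d]] by (auto simp: g'_def)
    ultimately show ?thesis
      by (simp add: has_field_derivative_def)
  qed
  have g'_eq: "g' t = (\<Sum>j\<in>UNIV. v $ j * w' (x + t *\<^sub>R v) (axis j 1))" if "\<bar>t\<bar> < e" for t
    unfolding g'_def by (rule linear_axis_expand) (use w'[OF inT[OF that]] has_derivative_linear in auto)
  define l where "l = (\<Sum>j\<in>UNIV. v $ j * w'' j v)"
  have "((\<lambda>t. \<Sum>j\<in>UNIV. v $ j * w' (x + t *\<^sub>R v) (axis j 1)) has_derivative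
      (\<lambda>s. \<Sum>j\<in>UNIV. v $ j * w'' j (s *\<^sub>R v))) (at 0)"
  proof (intro has_derivative_sum has_derivative_mult_right)
    fix j
    have "((\<lambda>y. w' y (axis j 1)) has_derivative w'' j) (at (x + 0 *\<^sub>R v))"
      using w'' by simp
    moreover have "((\<lambda>t. x + t *\<^sub>R v) has_derivative (\<lambda>s. s *\<^sub>R v)) (at 0)"
      by (auto intro!: derivative_eq_intros)
    ultimately show "((\<lambda>t. w' (x + t *\<^sub>R v) (axis j 1)) has_derivative (\<lambda>s. w'' j (s *\<^sub>R v))) (at 0)"
      by (rule has_derivative_compose[rotated])
  qed
  moreover have "(\<lambda>s. \<Sum>j\<in>UNIV. v $ j * w'' j (s *\<^sub>R v)) = (*) l"
  proof
    fix s
    have "w'' j (s *\<^sub>R v) = s * w'' j v" for j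
      using linear_cmul[OF has_derivative_linear[OF w'']] by auto
    then show "(\<Sum>j\<in>UNIV. v $ j * w'' j (s *\<^sub>R v)) = l * s"
      by (simp add: l_def sum_distrib_left sum_distrib_right algebra_simps)
  qed
  ultimately have "((\<lambda>t. \<Sum>j\<in>UNIV. v $ j * w' (x + t *\<^sub>R v) (axis j 1)) has_real_derivative l) (at 0)"
    by (simp add: has_field_derivative_def)
  then have l: "(g' has_real_derivative l) (at 0)"
  proof (rule DERIV_cong_ev[THEN iffD1, rotated -1])
    show "\<forall>\<^sub>F t in nhds 0. (\<Sum>j\<in>UNIV. v $ j * w' (x + t *\<^sub>R v) (axis j 1)) = g' t"
      using g'_eq e by (auto simp: eventually_nhds_metric dist_real_def)
  qed auto
  have gmax: "g t \<le> g 0" if "\<bar>t\<bar> < e" for t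
    using max[OF inT[OF that]] by (simp add: g_def)
  note t = second_derivative_test_real[OF e g' l gmax]
  from t(1) show "w' x v = 0" by (simp add: g'_def)
  have "w'' j v = (\<Sum>i\<in>UNIV. v $ i * w'' j (axis i 1))" for j
    by (rule linear_axis_expand) (rule has_derivative_linear[OF w''])
  then have "l = (\<Sum>j\<in>UNIV. \<Sum>i\<in>UNIV. w'' j (axis i 1) * v $ i * v $ j)"
    by (simp add: l_def sum_distrib_left algebra_simps)
  also have "\<dots> = (\<Sum>i\<in>UNIV. \<Sum>j\<in>UNIV. w'' j (axis i 1) * v $ i * v $ j)"
    by (rule sum.swap)
  finally show "(\<Sum>i\<in>UNIV. \<Sum>j\<in>UNIV. w'' j (axis i 1) * v $ i * v $ j) \<le> 0"
    using t(2) by simp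
qed


section \<open>The Hopf boundary point lemma\<close>

text \<open>Comparison with a radial barrier that is constant on the sphere and strictly increases
  towards the centre. Adding a small multiple of it to \<open>w\<close> still leaves the maximum
  over the ball at \<open>z\<close>, so \<open>w\<close> itself must decrease strictly from
  \<open>z\<close> inwards. The derivative is taken within a set \<open>S\<close> containing the
  ball, so that the lemma serves at interior points and at points of the flat boundary
  alike.\<close>

lemma hopf_boundary_point:
  fixes w :: "real ^ 'n \<Rightarrow> real" and A :: "'n \<Rightarrow> 'n \<Rightarrow> real ^ 'n \<Rightarrow> real"
  assumes R: "0 < R"
    and w': "\<And>x. x \<in> ball y R \<Longrightarrow> (w has_derivative w' x) (at x)"
    and w'': "\<And>x j. x \<in> ball y R \<Longrightarrow> ((\<lambda>x. w' x (axis j 1)) has_derivative w'' j x) (at x)"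
    and contw: "continuous_on (cball y R) w"
    and contA: "\<And>i j. continuous_on (cball y R) (A i j)"
    and contb: "\<And>j. continuous_on (cball y R) (b j)"
    and symA: "\<And>i j x. x \<in> cball y R \<Longrightarrow> A i j x = A j i x"
    and posA: "\<And>x v. x \<in> cball y R \<Longrightarrow> v \<noteq> 0 \<Longrightarrow>
        0 < (\<Sum>i\<in>UNIV. \<Sum>j\<in>UNIV. A i j x * v $ i * v $ j)"
    and sub: "\<And>x. x \<in> ball y R \<Longrightarrow>
        0 \<le> (\<Sum>i\<in>UNIV. \<Sum>j\<in>UNIV. A i j x * w'' j x (axis i 1)) + (\<Sum>j\<in>UNIV. b j x * w' x (axis j 1))"
    and lt: "\<And>x. x \<in> ball y R \<Longrightarrow> w x < m"
    and z: "dist y z = R" "w z = m"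
    and D: "(w has_derivative D) (at z within S)" and S: "cball y R \<subseteq> S"
  shows "0 < D (z - y)"
proof -
  \<comment> \<open>\<open>q\<close> and \<open>B\<close> are what the operator produces from the
    Gaussian below: applied to \<open>E\<close> it gives
    \<open>2 * k * E x * (2 * k * q x - B x)\<close>, as \<open>LE\<close> verifies.\<close>
  define q where "q = (\<lambda>x. \<Sum>i\<in>UNIV. \<Sum>j\<in>UNIV. A i j x * (x - y) $ i * (x - y) $ j)"
  define B where "B = (\<lambda>x. (\<Sum>i\<in>UNIV. A i i x) + (\<Sum>j\<in>UNIV. b j x * (x - y) $ j))"
  let ?Ann = "cball y R - ball y (R / 2)"
  have Ann: "compact ?Ann" "?Ann \<noteq> {}" "?Ann \<subseteq> cball y R"
    using z R by (auto intro!: compact_diff exI[of _ z])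
  have "continuous_on ?Ann q" unfolding q_def
    by (intro continuous_intros continuous_on_subset[OF contA] Ann(3))
  then obtain xq where xq: "xq \<in> ?Ann" "\<And>x. x \<in> ?Ann \<Longrightarrow> q xq \<le> q x"
    using continuous_attains_inf[OF Ann(1,2)] by blast
  define \<kappa> where "\<kappa> = q xq"
  \<comment> \<open>Removing the inner ball keeps \<open>x - y\<close> away from 0, where
    \<open>q\<close> would vanish.\<close>
  have \<kappa>: "0 < \<kappa>" unfolding \<kappa>_def q_def
    using xq(1) R by (intro posA) auto
  have "continuous_on ?Ann B" unfolding B_def
    by (intro continuous_intros continuous_on_subset[OF contA] continuous_on_subset[OF contb] Ann(3))
  then obtain xB where xB: "\<And>x. x \<in> ?Ann \<Longrightarrow> B x \<le> B xB"
    using continuous_attains_sup[OF Ann(1,2)] by blast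
  \<comment> \<open>Chosen so that \<open>2 * k * \<kappa>\<close> exceeds the maximum of
    \<open>B\<close> on the annulus.\<close>
  define k where "k = (\<bar>B xB\<bar> + 1) / (2 * \<kappa>)"
  have k: "0 < k" using \<kappa> by (simp add: k_def add_nonneg_pos)
  have kB: "0 < 2 * k * q x - B x" if "x \<in> ?Ann" for x
  proof -
    have "B x < 2 * k * \<kappa>" using xB[OF that] \<kappa> by (simp add: k_def)
    also have "\<dots> \<le> 2 * k * q x" using xq(2)[OF that] k by (simp add: \<kappa>_def)
    finally show ?thesis by simp
  qed
  \<comment> \<open>Hopf's barrier \<open>E\<close>: the choice of \<open>k\<close> makes it strictly subharmonic on the annulus \<open>R / 2 \<le> dist y x \<le> R\<close>.\<close>
  define E where "E = (\<lambda>x. exp (- k * ((x - y) \<bullet> (x - y))))"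
  define E' where "E' = (\<lambda>x v. - 2 * k * ((x - y) \<bullet> v) * E x)"
  define E'' where "E'' = (\<lambda>j x v. (4 * k\<^sup>2 * ((x - y) \<bullet> v) * (x - y) $ j - 2 * k * v $ j) * E x)"
  have Epos: "0 < E x" for x by (simp add: E_def)
  have E': "(E has_derivative E' x) (at x within X)" for x X
    unfolding E_def E'_def
    by (auto intro!: derivative_eq_intros simp: inner_commute algebra_simps)
  have E'': "((\<lambda>x. E' x (axis j 1)) has_derivative E'' j x) (at x)" for j x
    unfolding E'_def E''_def
    by (rule derivative_eq_intros E' refl)+
      (auto simp: E'_def inner_axis algebra_simps power2_eq_square)
  have LE: "(\<Sum>i\<in>UNIV. \<Sum>j\<in>UNIV. A i j x * E'' j x (axis i 1)) + (\<Sum>j\<in>UNIV. b j x * E' x (axis j 1))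
      = 2 * k * E x * (2 * k * q x - B x)" for x
  proof -
    have e: "A i j x * E'' j x (axis i 1) = 4 * k\<^sup>2 * E x * (A i j x * (x - y) $ i * (x - y) $ j)
        - 2 * k * E x * (if j = i then A i i x else 0)" for i j
    proof -
      have "axis i (1::real) $ j = (if j = i then 1 else 0)" by (simp add: axis_def)
      then show ?thesis by (simp add: E''_def inner_axis algebra_simps)
    qed
    have "(\<Sum>i\<in>UNIV. \<Sum>j\<in>UNIV. A i j x * E'' j x (axis i 1))
      = 4 * k\<^sup>2 * E x * q x - 2 * k * E x * (\<Sum>i\<in>UNIV. A i i x)"
      unfolding e sum_subtractf sum_distrib_left[symmetric] q_def by simp
    moreover have "(\<Sum>j\<in>UNIV. b j x * E' x (axis j 1)) = - 2 * k * E x * (\<Sum>j\<in>UNIV. b j x * (x - y) $ j)"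
      by (simp add: E'_def inner_axis sum_distrib_left algebra_simps)
    ultimately show ?thesis
      by (simp add: B_def algebra_simps power2_eq_square)
  qed
  have half: "cball y (R / 2) \<subseteq> ball y R" using R by auto
  have "continuous_on (cball y (R / 2)) w"
    by (rule continuous_on_subset[OF contw]) (use half ball_subset_cball in blast)
  then obtain xm where xm: "xm \<in> cball y (R / 2)" "\<And>x. x \<in> cball y (R / 2) \<Longrightarrow> w x \<le> w xm"
    using continuous_attains_sup[of "cball y (R / 2)" w] R by auto
  \<comment> \<open>The gap between \<open>m\<close> and \<open>w\<close> on the inner ball. As
    \<open>E\<close> is at most 1, adding \<open>\<delta> * E\<close> and subtracting
    \<open>\<delta> * ER\<close> cannot lift \<psi> above \<open>m\<close> there, and on the sphere
    the two terms cancel.\<close>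
  define \<delta> where "\<delta> = m - w xm"
  have \<delta>: "0 < \<delta>" using lt xm(1) half by (auto simp: \<delta>_def)
  have wle: "w x \<le> m" if "x \<in> cball y R" for x
    using continuous_le_on_closure[of "ball y R" w x m] that contw lt R by (auto intro: less_imp_le)
  define ER where "ER = exp (- k * R\<^sup>2)"
  have E_sphere: "E x = ER" if "dist y x = R" for x
    using that by (auto simp: E_def ER_def dist_norm norm_minus_commute power2_norm_eq_inner[symmetric])
  define \<psi> where "\<psi> = (\<lambda>x. w x + \<delta> * E x - \<delta> * ER)"
  define \<psi>' where "\<psi>' = (\<lambda>x v. w' x v + \<delta> * E' x v)"
  define \<psi>'' where "\<psi>'' = (\<lambda>j x v. w'' j x v + \<delta> * E'' j x v)"
  have \<psi>': "(\<psi> has_derivative \<psi>' x) (at x)" if "x \<in> ball y R" for x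
    unfolding \<psi>_def \<psi>'_def by (auto intro!: derivative_eq_intros w'[OF that] E')
  have \<psi>'': "((\<lambda>x. \<psi>' x (axis j 1)) has_derivative \<psi>'' j x) (at x)" if "x \<in> ball y R" for x j
    unfolding \<psi>''_def \<psi>'_def by (auto intro!: derivative_eq_intros w''[OF that] E'')
  have "continuous_on (cball y R) \<psi>"
    unfolding \<psi>_def E_def by (intro continuous_intros contw)
  then obtain x0 where x0: "x0 \<in> cball y R" "\<And>x. x \<in> cball y R \<Longrightarrow> \<psi> x \<le> \<psi> x0"
    using continuous_attains_sup[of "cball y R" \<psi>] R by auto
  have "\<psi> x0 \<le> m"
  proof (rule ccontr)
    assume a: "\<not> \<psi> x0 \<le> m"
    have "x0 \<notin> cball y (R / 2)"
    proof
      assume "x0 \<in> cball y (R / 2)"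
      then have "w x0 \<le> m - \<delta>" using xm by (simp add: \<delta>_def)
      moreover have "E x0 \<le> 1" using k by (simp add: E_def)
      then have "\<delta> * E x0 \<le> \<delta> * 1" using \<delta> by (intro mult_left_mono) auto
      moreover have "0 < \<delta> * ER" using \<delta> by (simp add: ER_def)
      ultimately show False using a by (simp add: \<psi>_def)
    qed
    moreover have "dist y x0 \<noteq> R"
      using E_sphere[of x0] wle[OF x0(1)] a by (auto simp: \<psi>_def)
    ultimately have xb: "x0 \<in> ball y R" and xA: "x0 \<in> ?Ann"
      using x0(1) by auto
    have mx: "\<psi> u \<le> \<psi> x0" if "u \<in> ball y R" for u using x0(2)[of u] that by auto
    \<comment> \<open>At an interior maximum the first-order part vanishes and the second-order part
      is at most 0. In the annulus this contradicts the strict positivity contributed by the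
      barrier.\<close>
    note sd = second_derivative_test[of "ball y R" x0 \<psi> \<psi>' "\<lambda>j. \<psi>'' j x0", OF open_ball xb \<psi>' \<psi>''[OF xb] mx]
    have "0 \<le> (\<Sum>i\<in>UNIV. \<Sum>j\<in>UNIV. A i j x0 * (- \<psi>'' j x0 (axis i 1)))"
    proof (rule pos_def_contraction_nonneg)
      fix v :: "'n \<Rightarrow> real" assume "\<exists>i\<in>UNIV. v i \<noteq> 0"
      then have "(\<chi> i. v i) \<noteq> 0" by (auto simp: vec_eq_iff)
      from posA[OF x0(1) this] show "0 < (\<Sum>i\<in>UNIV. \<Sum>j\<in>UNIV. A i j x0 * v i * v j)" by simp
    next
      fix v :: "'n \<Rightarrow> real"
      show "0 \<le> (\<Sum>i\<in>UNIV. \<Sum>j\<in>UNIV. - \<psi>'' j x0 (axis i 1) * v i * v j)"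
        using sd(2)[of "\<chi> i. v i"] by (simp add: sum_negf)
    qed (use symA x0(1) in auto)
    then have "(\<Sum>i\<in>UNIV. \<Sum>j\<in>UNIV. A i j x0 * \<psi>'' j x0 (axis i 1)) \<le> 0"
      by (simp add: sum_negf)
    moreover have "(\<Sum>j\<in>UNIV. b j x0 * \<psi>' x0 (axis j 1)) = 0"
      using sd(1) by simp
    moreover have "(\<Sum>i\<in>UNIV. \<Sum>j\<in>UNIV. A i j x0 * \<psi>'' j x0 (axis i 1)) + (\<Sum>j\<in>UNIV. b j x0 * \<psi>' x0 (axis j 1))
      = ((\<Sum>i\<in>UNIV. \<Sum>j\<in>UNIV. A i j x0 * w'' j x0 (axis i 1)) + (\<Sum>j\<in>UNIV. b j x0 * w' x0 (axis j 1)))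
      + \<delta> * ((\<Sum>i\<in>UNIV. \<Sum>j\<in>UNIV. A i j x0 * E'' j x0 (axis i 1)) + (\<Sum>j\<in>UNIV. b j x0 * E' x0 (axis j 1)))"
      by (simp add: \<psi>''_def \<psi>'_def algebra_simps sum.distrib sum_distrib_left)
    moreover have "0 < \<delta> * (2 * k * E x0 * (2 * k * q x0 - B x0))"
      using \<delta> k Epos kB[OF xA] by simp
    ultimately show False
      using sub[OF xb] unfolding LE by linarith
  qed
  then have \<psi>le: "\<psi> x \<le> m" if "x \<in> cball y R" for x
    using x0(2)[OF that] by simp
  have \<psi>z: "\<psi> z = m" using z E_sphere by (simp add: \<psi>_def)
  \<comment> \<open>The derivative of \<psi> at \<open>z\<close> towards the centre. It is at most 0
    because \<psi> is maximal at \<open>z\<close>, while its barrier term is positive; the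
    difference is the sign of \<open>D\<close>.\<close>
  define l where "l = D (y - z) + \<delta> * E' z (y - z)"
  have seg: "z + t *\<^sub>R (y - z) \<in> cball y R" if "t \<in> {0..1}" for t
  proof -
    have "y - (z + t *\<^sub>R (y - z)) = (1 - t) *\<^sub>R (y - z)" by (simp add: algebra_simps)
    then have "dist y (z + t *\<^sub>R (y - z)) = (1 - t) * R"
      using that z by (simp add: dist_norm)
    also have "\<dots> \<le> 1 * R" using that R by (intro mult_right_mono) auto
    finally show ?thesis by simp
  qed
  have d\<psi>: "(\<psi> has_derivative (\<lambda>v. D v + \<delta> * E' z v)) (at z within S)"
    unfolding \<psi>_def by (auto intro!: derivative_eq_intros D E')
  have d\<psi>1: "(\<psi> has_derivative (\<lambda>v. D v + \<delta> * E' z v)) (at (z + 0 *\<^sub>R (y - z)) within (\<lambda>t. z + t *\<^sub>R (y - z)) ` {0..1})"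
    by simp (rule has_derivative_subset[OF d\<psi>], use seg S in auto)
  have "((\<lambda>t. z + t *\<^sub>R (y - z)) has_derivative (\<lambda>s. s *\<^sub>R (y - z))) (at 0 within {0..1})"
    by (auto intro!: derivative_eq_intros)
  from has_derivative_in_compose[OF this d\<psi>1]
  have "((\<lambda>t. \<psi> (z + t *\<^sub>R (y - z))) has_derivative (\<lambda>s. D (s *\<^sub>R (y - z)) + \<delta> * E' z (s *\<^sub>R (y - z)))) (at 0 within {0..1})" .
  moreover have "(\<lambda>s. D (s *\<^sub>R (y - z)) + \<delta> * E' z (s *\<^sub>R (y - z))) = (*) l"
    using linear_cmul[OF has_derivative_linear[OF d\<psi>], of _ "y - z"]
    by (auto simp: l_def algebra_simps)
  ultimately have dl: "((\<lambda>t. \<psi> (z + t *\<^sub>R (y - z))) has_real_derivative l) (at 0 within {0..1})"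
    by (simp add: has_field_derivative_def)
  have "l \<le> 0"
  proof (rule ccontr)
    assume "\<not> l \<le> 0"
    then obtain d where d: "0 < d" "\<And>h. 0 < h \<Longrightarrow> 0 + h \<in> {0..1} \<Longrightarrow> h < d \<Longrightarrow>
        \<psi> (z + 0 *\<^sub>R (y - z)) < \<psi> (z + (0 + h) *\<^sub>R (y - z))"
      using has_real_derivative_pos_inc_right[OF dl] by auto
    define h where "h = min 1 (d / 2)"
    have "0 < h" "h \<in> {0..1}" "h < d" using d(1) by (auto simp: h_def)
    then have "m < \<psi> (z + h *\<^sub>R (y - z))" using d(2)[of h] \<psi>z by simp
    with \<psi>le[OF seg] \<open>h \<in> {0..1}\<close> show False by fastforce
  qed
  moreover have "E' z (y - z) = 2 * k * R\<^sup>2 * E z"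
  proof -
    have "(z - y) \<bullet> (y - z) = - R\<^sup>2"
      using z by (metis dist_norm inner_minus_right minus_diff_eq norm_minus_commute power2_norm_eq_inner)
    then show ?thesis by (simp add: E'_def)
  qed
  then have "0 < \<delta> * E' z (y - z)" using \<delta> k R Epos by simp
  moreover have "D (y - z) = - D (z - y)"
    using linear_neg[OF has_derivative_linear[OF D], of "z - y"] by simp
  ultimately show ?thesis by (simp add: l_def)
qed


section \<open>The strong maximum principle in a half-space\<close>

lemma openin_half_space_ball:
  assumes "openin (top_of_set half_space) S" "x \<in> S"
  obtains r where "0 < r" "ball x r \<inter> half_space \<subseteq> S"
  using assms by (metis inf_commute openin_contains_ball)

text \<open>Away from the boundary, Hopf's lemma contradicts the vanishing gradient at a maximum. At
  a boundary point \<open>p\<close>, the open half-ball above \<open>p\<close> either contains no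
  maximum point, and Hopf's lemma at \<open>p\<close> contradicts \<open>bdry\<close>, or consists
  of maximum points only, and continuity extends this to the flat face.\<close>

lemma half_space_strong_maximum:
  fixes w :: "real ^ 'n::finite \<Rightarrow> real" and A :: "'n \<Rightarrow> 'n \<Rightarrow> real ^ 'n \<Rightarrow> real"
  assumes S: "openin (top_of_set half_space) S"
    and w': "\<And>x. x \<in> S \<Longrightarrow> (w has_derivative w' x) (at x within S)"
    and w'': "\<And>x j. x \<in> S \<Longrightarrow> ((\<lambda>x. w' x (axis j 1)) has_derivative w'' j x) (at x within S)"
    and contA: "\<And>i j. continuous_on S (A i j)"
    and contb: "\<And>j. continuous_on S (b j)"
    and symA: "\<And>i j x. x \<in> S \<Longrightarrow> A i j x = A j i x"
    and posA: "\<And>x v. x \<in> S \<Longrightarrow> v \<noteq> 0 \<Longrightarrow>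
        0 < (\<Sum>i\<in>UNIV. \<Sum>j\<in>UNIV. A i j x * v $ i * v $ j)"
    and sub: "\<And>x. x \<in> S \<Longrightarrow> 0 < x $ bdry_coord \<Longrightarrow>
        0 \<le> (\<Sum>i\<in>UNIV. \<Sum>j\<in>UNIV. A i j x * w'' j x (axis i 1)) + (\<Sum>j\<in>UNIV. b j x * w' x (axis j 1))"
    and le: "\<And>x. x \<in> S \<Longrightarrow> w x \<le> m"
    and p: "p \<in> S" "w p = m"
    and bdry: "p $ bdry_coord = 0 \<Longrightarrow> \<exists>N. w' p N = 0 \<and> N $ bdry_coord < 0"
  shows "\<exists>e>0. \<forall>x\<in>S \<inter> ball p e. w x = m"
proof -
  define I where "I = {x \<in> S. 0 < x $ bdry_coord}"
  obtain T where T: "open T" "S = half_space \<inter> T"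
    using S by (auto simp: openin_open)
  have "I = T \<inter> {x. 0 < x $ bdry_coord}"
    by (auto simp: I_def T half_space_def)
  then have I_open: "open I"
    using T(1) by (auto intro!: open_Int open_Collect_less continuous_intros)
  have contw: "continuous_on S w"
    using w' by (auto simp: continuous_on_eq_continuous_within intro: has_derivative_continuous)
  have IS: "I \<subseteq> S" by (auto simp: I_def)
  have atI: "at x within S = at x" if "x \<in> I" for x
    using that I_open IS by (metis at_within_open_subset)
  have wI: "(w has_derivative w' x) (at x)" if "x \<in> I" for x
    using w'[of x] atI[OF that] that IS by (metis subsetD)
  have wI2: "((\<lambda>x. w' x (axis j 1)) has_derivative w'' j x) (at x)" if "x \<in> I" for x j
    using w''[of x j] atI[OF that] that IS by (metis subsetD)
  note hopf = hopf_boundary_point[where S = S and w = w and w' = w' and w'' = w'' and A = A and b = b]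
  \<comment> \<open>The ball around \<open>x\<close> is enlarged until it first meets a maximum
    point \<open>z\<close>; there Hopf's lemma applies. Since \<open>q\<close> is a maximum point,
    this happens within distance \<open>dist x q\<close>, and the radius \<open>2 * r\<close> keeps
    the ball inside \<open>I\<close>.\<close>
  have intr: "w x = m" if r: "ball q (2 * r) \<subseteq> I" and q: "w q = m" and x: "x \<in> ball q r" for q r x
  proof (rule ccontr)
    assume "w x \<noteq> m"
    have cb: "cball x (dist x q) \<subseteq> I"
    proof
      fix u assume "u \<in> cball x (dist x q)"
      then have "dist q u < 2 * r"
        using x dist_triangle[of q u x] by (auto simp: dist_commute)
      with r show "u \<in> I" by auto
    qed
    define K where "K = {u \<in> cball x (dist x q). w u = m}"
    have "closed K"
      unfolding K_def by (rule continuous_closed_preimage_constant)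
        (use continuous_on_subset[OF contw] cb IS in auto)
    moreover have "q \<in> K" using q by (auto simp: K_def)
    ultimately obtain z where z: "z \<in> K" "\<And>u. u \<in> K \<Longrightarrow> dist x z \<le> dist x u"
      using distance_attains_inf[of K x] by blast
    define R where "R = dist x z"
    have R: "0 < R" "cball x R \<subseteq> I"
      using z \<open>w x \<noteq> m\<close> cb by (auto simp: R_def K_def)
    have zI: "z \<in> I" "w z = m" using z cb by (auto simp: K_def)
    have lt: "w u < m" if "u \<in> ball x R" for u
    proof -
      have "u \<in> S" using R(2) that IS by (meson ball_subset_cball subsetD)
      moreover have "w u \<noteq> m"
      proof
        assume "w u = m"
        then have "u \<in> K" using that z(1) by (auto simp: K_def R_def)
        then show False using z(2)[of u] that by (auto simp: R_def)
      qed
      ultimately show ?thesis using le[of u] by simp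
    qed
    have sub1: "cball x R \<subseteq> S" "ball x R \<subseteq> I"
      using R(2) IS by (auto dest: subsetD[OF ball_subset_cball])
    have "0 < w' z (z - x)"
    proof (rule hopf[of R x m z])
      show "(w has_derivative w' u) (at u)" if "u \<in> ball x R" for u
        using wI sub1 that by blast
      show "((\<lambda>x. w' x (axis j 1)) has_derivative w'' j u) (at u)" if "u \<in> ball x R" for u j
        using wI2 sub1 that by blast
      show "(w has_derivative w' z) (at z within S)"
        using zI IS w' by auto
    qed (use R lt zI sub1 symA posA sub IS I_def in \<open>auto intro: continuous_on_subset[OF contw]
        continuous_on_subset[OF contA] continuous_on_subset[OF contb] simp: R_def\<close>)
    moreover have "w' z (z - x) = 0"
    proof (rule second_derivative_test(1))
      show "open I" "z \<in> I" by fact+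
      show "(w has_derivative w' u) (at u)" if "u \<in> I" for u
        using wI that by blast
      show "((\<lambda>x. w' x (axis j 1)) has_derivative w'' j z) (at z)" for j
        using wI2 zI by blast
    qed (use le zI IS in auto)
    ultimately show False by simp
  qed
  show ?thesis
  proof (cases "p $ bdry_coord = 0")
    case False
    then have "p \<in> I" using p T by (auto simp: I_def half_space_def)
    then obtain r where r: "0 < r" "ball p r \<subseteq> I" using I_open openE by blast
    then have "\<forall>x\<in>S \<inter> ball p (r / 2). w x = m"
      using intr[of p "r / 2"] p by auto
    then show ?thesis using r by (intro exI[of _ "r / 2"]) auto
  next
    case True
    obtain r where r: "0 < r" "ball p r \<inter> half_space \<subseteq> S"
      using openin_half_space_ball[OF S p(1)] .
    define J where "J = ball p r \<inter> {x. 0 < x $ bdry_coord}"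
    have JI: "J \<subseteq> I" using r by (auto simp: J_def I_def half_space_def)
    have "open J" unfolding J_def
      by (auto intro!: open_Int open_Collect_less continuous_intros)
    have "convex {x :: real ^ 'n. 0 < x $ bdry_coord}"
      using convex_halfspace_gt[of 0 "axis bdry_coord 1 :: real ^ 'n"] by (simp add: inner_axis' )
    then have "connected J" unfolding J_def by (intro convex_connected convex_Int) auto
    \<comment> \<open>Open by \<open>intr\<close> and relatively closed by continuity, hence empty
      or all of the convex set \<open>J\<close>.\<close>
    define Z where "Z = {x \<in> J. w x = m}"
    have "open Z"
    proof (rule openI)
      fix x assume x: "x \<in> Z"
      then obtain e where e: "0 < e" "ball x e \<subseteq> J" using \<open>open J\<close> openE by (auto simp: Z_def)
      have "ball x (e / 2) \<subseteq> Z"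
        using intr[of x "e / 2"] e JI x by (auto simp: Z_def)
      then show "\<exists>e>0. ball x e \<subseteq> Z" using e by (meson half_gt_zero)
    qed
    then have "openin (top_of_set J) Z" by (simp add: Z_def open_openin_trans \<open>open J\<close> openin_open_eq)
    moreover have "closedin (top_of_set J) Z"
      unfolding Z_def by (rule continuous_closedin_preimage_constant)
        (use continuous_on_subset[OF contw] JI IS in auto)
    ultimately consider "Z = {}" | "Z = J"
      using \<open>connected J\<close> by (auto simp: connected_clopen)
    then show ?thesis
    proof cases
      case 1
      define e :: "real ^ 'n" where "e = axis bdry_coord 1"
      \<comment> \<open>The ball of radius \<open>r / 3\<close> about \<open>y\<close> touches the
        boundary hyperplane at \<open>p\<close>, and it stays in \<open>ball p r\<close> because
        \<open>2 * r / 3 < r\<close>.\<close>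
      define y where "y = p + (r / 3) *\<^sub>R e"
      have yp: "dist y p = r / 3" using r by (simp add: y_def e_def dist_norm)
      have incb: "cball y (r / 3) \<subseteq> ball p r"
      proof
        fix u assume "u \<in> cball y (r / 3)"
        then show "u \<in> ball p r"
          using dist_triangle[of p u y] yp r by (auto simp: dist_commute)
      qed
      have comp: "\<bar>y $ bdry_coord - u $ bdry_coord\<bar> \<le> dist y u" for u
        using component_le_norm_cart[of "y - u" bdry_coord] by (simp add: dist_norm)
      have yb: "y $ bdry_coord = r / 3" using True by (simp add: y_def e_def axis_def)
      have "cball y (r / 3) \<subseteq> half_space"
      proof
        fix u assume "u \<in> cball y (r / 3)"
        then show "u \<in> half_space" using comp[of u] yb by (auto simp: half_space_def)
      qed
      then have cS: "cball y (r / 3) \<subseteq> S" using incb r by auto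
      have bJ: "ball y (r / 3) \<subseteq> J"
      proof
        fix u assume u: "u \<in> ball y (r / 3)"
        then have "u \<in> ball p r" using incb by (meson ball_subset_cball subsetD)
        then show "u \<in> J" using comp[of u] yb u by (auto simp: J_def)
      qed
      have "0 < w' p (p - y)"
      proof (rule hopf[of "r / 3" y m p])
        show "(w has_derivative w' u) (at u)" if "u \<in> ball y (r / 3)" for u
          using wI bJ JI that by blast
        show "((\<lambda>x. w' x (axis j 1)) has_derivative w'' j u) (at u)" if "u \<in> ball y (r / 3)" for u j
          using wI2 bJ JI that by blast
        show "w u < m" if "u \<in> ball y (r / 3)" for u
          using that bJ 1 le[of u] JI IS by (force simp: Z_def)
        show "0 \<le> (\<Sum>i\<in>UNIV. \<Sum>j\<in>UNIV. A i j u * w'' j u (axis i 1)) + (\<Sum>j\<in>UNIV. b j u * w' u (axis j 1))"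
          if "u \<in> ball y (r / 3)" for u
          using that bJ JI by (intro sub) (auto simp: I_def)
        show "(w has_derivative w' p) (at p within S)"
          using p w' by auto
      qed (use r cS symA posA p yp in \<open>auto intro: continuous_on_subset[OF contw]
          continuous_on_subset[OF contA] continuous_on_subset[OF contb]\<close>)
      moreover have "p - y = (- r / 3) *\<^sub>R e" by (simp add: y_def)
      ultimately have "0 < w' p ((- r / 3) *\<^sub>R e)" by metis
      moreover have lin: "linear (w' p)" using w'[OF p(1)] by (rule has_derivative_linear)
      ultimately have neg: "w' p e < 0"
        using linear_cmul[OF lin, of "- r / 3" e] r by (simp add: mult_less_0_iff)
      \<comment> \<open>Tangential lines through \<open>p\<close> stay in the half-space in both
        directions, so \<open>p\<close> is a two-sided maximum along them. Hence
        \<open>w' p N\<close> reduces to the normal component of \<open>N\<close> times the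
        derivative along \<open>e\<close>, a product of two negative numbers.\<close>
      have tang: "w' p (axis i 1) = 0" if i: "i \<noteq> bdry_coord" for i
      proof -
        have seg: "p + t *\<^sub>R axis i 1 \<in> S" if "t \<in> {-r<..<r}" for t
        proof -
          have "p + t *\<^sub>R axis i 1 \<in> half_space"
            using True i by (simp add: half_space_def axis_def)
          moreover have "p + t *\<^sub>R axis i 1 \<in> ball p r"
            using that by (auto simp: dist_norm)
          ultimately show ?thesis using r by auto
        qed
        have d1: "(w has_derivative w' p) (at (p + 0 *\<^sub>R axis i 1) within (\<lambda>t. p + t *\<^sub>R axis i 1) ` {-r<..<r})"
          by simp (rule has_derivative_subset[OF w'[OF p(1)]], use seg in auto)
        have "((\<lambda>t. p + t *\<^sub>R axis i 1) has_derivative (\<lambda>s. s *\<^sub>R axis i 1)) (at 0 within {-r<..<r})"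
          by (auto intro!: derivative_eq_intros)
        from has_derivative_in_compose[OF this d1]
        have "((\<lambda>t. w (p + t *\<^sub>R axis i 1)) has_derivative (\<lambda>s. w' p (s *\<^sub>R axis i 1))) (at 0 within {-r<..<r})" .
        moreover have "(\<lambda>s. w' p (s *\<^sub>R axis i 1)) = (*) (w' p (axis i 1))"
          using lin by (auto simp: linear_cmul)
        ultimately have "((\<lambda>t. w (p + t *\<^sub>R axis i 1)) has_real_derivative w' p (axis i 1)) (at 0)"
          using r by (simp add: has_field_derivative_def at_within_open[of 0 "{-r<..<r}"])
        then show ?thesis
        proof (rule DERIV_local_max[OF _ r(1)])
          show "\<forall>t. \<bar>0 - t\<bar> < r \<longrightarrow> w (p + t *\<^sub>R axis i 1) \<le> w (p + 0 *\<^sub>R axis i 1)"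
            using le[OF seg] p by (auto simp: abs_less_iff)
        qed
      qed
      obtain N where N: "w' p N = 0" "N $ bdry_coord < 0" using bdry[OF True] by blast
      have "w' p N = (\<Sum>i\<in>UNIV. N $ i * w' p (axis i 1))" by (rule linear_axis_expand[OF lin])
      also have "\<dots> = (\<Sum>i\<in>UNIV. if i = (bdry_coord :: 'n) then N $ bdry_coord * w' p e else 0)"
        by (intro sum.cong) (auto simp: tang e_def)
      also have "\<dots> = N $ bdry_coord * w' p e" by simp
      also have "\<dots> > 0" using N neg by (simp add: mult_neg_neg)
      finally show ?thesis using N by simp
    next
      case 2
      have "w x = m" if x: "x \<in> S \<inter> ball p r" for x
      proof (cases "x $ bdry_coord = 0")
        case False
        then have "x \<in> J" using x T by (auto simp: J_def half_space_def)
        with 2 show ?thesis by (auto simp: Z_def)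
      next
        case xb: True
        show ?thesis
        proof (rule ccontr)
          assume "w x \<noteq> m"
          then have "w x < m" using le[of x] x by auto
          then obtain d where d: "0 < d" "\<And>u. u \<in> S \<Longrightarrow> dist u x < d \<Longrightarrow> dist (w u) (w x) < m - w x"
            using contw x by (auto simp: continuous_on_iff) (metis diff_gt_0_iff_gt)
          \<comment> \<open>A shift off the flat face, small enough to remain in
            \<open>ball p r\<close> and within the continuity radius at \<open>x\<close>.\<close>
          define t where "t = min d (r - dist p x) / 2"
          have t: "0 < t" "t < d" "t < r - dist p x" using d x by (auto simp: t_def min_def)
          define u where "u = x + t *\<^sub>R axis bdry_coord 1"
          have ux: "dist u x = t" using t by (simp add: u_def dist_norm)
          have "dist p u < r" using dist_triangle[of p u x] ux t by (simp add: dist_commute)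
          moreover have "0 < u $ bdry_coord" using xb t by (simp add: u_def)
          ultimately have "u \<in> J" by (auto simp: J_def)
          then have "u \<in> S" "w u = m" using 2 JI IS by (auto simp: Z_def)
          with d(2)[of u] ux t show False by (auto simp: dist_real_def)
        qed
      qed
      then show ?thesis using r by auto
    qed
  qed
qed


section \<open>Continuously differentiable coefficients\<close>

text \<open>This is \<open>Ck_on 1\<close> with the recursion unfolded. One derivative is the right
  amount because the divergence form of the Laplacian differentiates the coefficients once.\<close>

definition C1_on :: "'d::euclidean_space set \<Rightarrow> ('d \<Rightarrow> 'b::real_normed_vector) \<Rightarrow> bool"
  where "C1_on S f \<longleftrightarrow> (\<exists>f'. (\<forall>x\<in>S. (f has_derivative f' x) (at x within S)) \<and>
     (\<forall>i\<in>Basis. continuous_on S (\<lambda>x. f' x i)))"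

lemma smooth_on_imp_C1_on:
  assumes "smooth_on S f"
  shows "C1_on S f"
proof -
  have "Ck_on 1 S f" using assms by (simp add: smooth_on_def)
  then show ?thesis by (simp add: Ck_on_def C1_on_def)
qed

lemma C1_on_imp_continuous_on:
  assumes "C1_on S f"
  shows "continuous_on S f"
  using assms unfolding C1_on_def continuous_on_eq_continuous_within
  by (auto intro: has_derivative_continuous)

lemma C1_on_cong:
  assumes "C1_on S f" "\<And>x. x \<in> S \<Longrightarrow> g x = f x"
  shows "C1_on S g"
proof -
  obtain f' where "\<forall>x\<in>S. (f has_derivative f' x) (at x within S)" "\<forall>i\<in>Basis. continuous_on S (\<lambda>x. f' x i)"
    using assms unfolding C1_on_def by blast
  then show ?thesis
    unfolding C1_on_def using assms(2)
    by (intro exI[of _ f']) (auto intro: has_derivative_transform)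
qed

lemma C1_on_bounded_linear:
  assumes "bounded_linear L" "C1_on S f"
  shows "C1_on S (\<lambda>x. L (f x))"
proof -
  obtain f' where "\<forall>x\<in>S. (f has_derivative f' x) (at x within S)" "\<forall>i\<in>Basis. continuous_on S (\<lambda>x. f' x i)"
    using assms unfolding C1_on_def by blast
  then show ?thesis
    unfolding C1_on_def using assms(1)
    by (intro exI[of _ "\<lambda>x v. L (f' x v)"])
      (auto intro: bounded_linear.has_derivative bounded_linear.continuous_on)
qed

lemma C1_on_const [intro]: "C1_on S (\<lambda>x. k)"
  unfolding C1_on_def by (rule exI[of _ "\<lambda>x v. 0"]) auto

lemma C1_on_add:
  assumes "C1_on S f" "C1_on S g"
  shows "C1_on S (\<lambda>x. f x + g x)"
proof -
  obtain f' g' where "\<forall>x\<in>S. (f has_derivative f' x) (at x within S)" "\<forall>i\<in>Basis. continuous_on S (\<lambda>x. f' x i)"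
     "\<forall>x\<in>S. (g has_derivative g' x) (at x within S)" "\<forall>i\<in>Basis. continuous_on S (\<lambda>x. g' x i)"
    using assms unfolding C1_on_def by blast
  then show ?thesis
    unfolding C1_on_def
    by (intro exI[of _ "\<lambda>x v. f' x v + g' x v"]) (auto intro!: derivative_eq_intros continuous_intros)
qed

lemma C1_on_mult:
  fixes f g :: "'d::euclidean_space \<Rightarrow> real"
  assumes f: "C1_on S f" and g: "C1_on S g"
  shows "C1_on S (\<lambda>x. f x * g x)"
proof -
  obtain f' g' where "\<forall>x\<in>S. (f has_derivative f' x) (at x within S)" "\<forall>i\<in>Basis. continuous_on S (\<lambda>x. f' x i)"
     "\<forall>x\<in>S. (g has_derivative g' x) (at x within S)" "\<forall>i\<in>Basis. continuous_on S (\<lambda>x. g' x i)"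
    using assms unfolding C1_on_def by blast
  moreover note f[THEN C1_on_imp_continuous_on] g[THEN C1_on_imp_continuous_on]
  ultimately show ?thesis
    unfolding C1_on_def
    by (intro exI[of _ "\<lambda>x v. f x * g' x v + f' x v * g x"])
      (auto intro!: has_derivative_mult continuous_intros)
qed

lemma C1_on_sum:
  assumes "\<And>i. i \<in> I \<Longrightarrow> C1_on S (f i)"
  shows "C1_on S (\<lambda>x. \<Sum>i\<in>I. f i x)"
  using assms by (induction I rule: infinite_finite_induct) (auto intro: C1_on_add)

lemma C1_on_prod:
  fixes f :: "'i \<Rightarrow> 'd::euclidean_space \<Rightarrow> real"
  assumes "\<And>i. i \<in> I \<Longrightarrow> C1_on S (f i)"
  shows "C1_on S (\<lambda>x. \<Prod>i\<in>I. f i x)"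
  using assms by (induction I rule: infinite_finite_induct) (auto intro: C1_on_mult)

lemma C1_on_compose_real:
  fixes f :: "'d::euclidean_space \<Rightarrow> real"
  assumes f: "C1_on S f"
    and g: "\<And>x. x \<in> S \<Longrightarrow> (g has_real_derivative g' (f x)) (at (f x))"
    and g': "continuous_on (f ` S) g'"
  shows "C1_on S (\<lambda>x. g (f x))"
proof -
  obtain f' where f': "\<forall>x\<in>S. (f has_derivative f' x) (at x within S)" "\<forall>i\<in>Basis. continuous_on S (\<lambda>x. f' x i)"
    using f unfolding C1_on_def by blast
  have "continuous_on S (\<lambda>x. g' (f x))"
    using continuous_on_compose[OF C1_on_imp_continuous_on[OF f] g'] by (simp add: o_def)
  moreover have "((\<lambda>x. g (f x)) has_derivative (\<lambda>v. f' x v * g' (f x))) (at x within S)" if "x \<in> S" for x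
    using f'(1) that by (intro DERIV_compose_FDERIV[where f = g and g = f] g) auto
  ultimately show ?thesis
    unfolding C1_on_def using f'(2)
    by (intro exI[of _ "\<lambda>x v. f' x v * g' (f x)"]) (auto intro!: continuous_intros)
qed

lemma C1_on_divide:
  fixes f g :: "'d::euclidean_space \<Rightarrow> real"
  assumes "C1_on S f" "C1_on S g" "\<And>x. x \<in> S \<Longrightarrow> g x \<noteq> 0"
  shows "C1_on S (\<lambda>x. f x / g x)"
proof -
  have "C1_on S (\<lambda>x. inverse (g x))"
    by (rule C1_on_compose_real[OF assms(2) DERIV_inverse])
      (use assms(3) in \<open>auto intro!: continuous_intros\<close>)
  then show ?thesis
    unfolding divide_inverse by (intro C1_on_mult assms(1))
qed

text \<open>Isabelle's \<^const>\<open>sqrt\<close> is odd, hence continuously differentiable away from \<open>0\<close>; this is why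
  the sign of the determinant of the metric plays no role below.\<close>

lemma C1_on_sqrt:
  fixes f :: "'d::euclidean_space \<Rightarrow> real"
  assumes "C1_on S f" "\<And>x. x \<in> S \<Longrightarrow> f x \<noteq> 0"
  shows "C1_on S (\<lambda>x. sqrt (f x))"
proof (rule C1_on_compose_real[OF assms(1), where g' = "\<lambda>t. inverse \<bar>sqrt t\<bar> / 2"])
  show "DERIV sqrt (f x) :> inverse \<bar>sqrt (f x)\<bar> / 2" if "x \<in> S" for x
    using assms(2)[OF that] by (intro DERIV_real_sqrt_generic) auto
qed (use assms(2) in \<open>auto intro!: continuous_intros\<close>)

lemma C1_on_matrix_component:
  fixes G :: "'d::euclidean_space \<Rightarrow> real ^ 'n ^ 'm"
  assumes "C1_on S G"
  shows "C1_on S (\<lambda>y. G y $ i $ j)"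
  by (intro C1_on_bounded_linear[OF bounded_linear_vec_nth] assms)

lemma C1_on_det:
  fixes G :: "'d::euclidean_space \<Rightarrow> real ^ 'n ^ 'n"
  assumes "\<And>i j. C1_on S (\<lambda>y. G y $ i $ j)"
  shows "C1_on S (\<lambda>y. det (G y))"
  unfolding det_def by (intro C1_on_sum C1_on_mult C1_on_prod C1_on_const assms)

section \<open>Inverses of positive definite matrices and their dependence on the entries\<close>

lemma matrix_inv_right_left:
  fixes A :: "real ^ 'n ^ 'n"
  assumes "det A \<noteq> 0"
  shows "A ** matrix_inv A = mat 1" "matrix_inv A ** A = mat 1"
proof -
  have "\<exists>B. A ** B = mat 1 \<and> B ** A = mat 1"
    using assms invertible_det_nz[of A] by (auto simp: invertible_def)
  from someI_ex[OF this] show "A ** matrix_inv A = mat 1" "matrix_inv A ** A = mat 1"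
    by (auto simp: matrix_inv_def)
qed

text \<open>Column \<open>j\<close> of the inverse solves the linear system with right-hand side
  \<open>axis j 1\<close>. Cramer's rule turns its entries into quotients of polynomials in the
  entries of \<open>A\<close>, which makes them continuously differentiable.\<close>

lemma matrix_inv_cramer:
  fixes A :: "real ^ 'n ^ 'n"
  assumes "det A \<noteq> 0"
  shows "matrix_inv A $ i $ j = det (\<chi> r s. if s = i then axis j 1 $ r else A $ r $ s) / det A"
proof -
  have "A *v (matrix_inv A *v axis j 1) = axis j 1"
    using matrix_inv_right_left[OF assms] by (simp add: matrix_vector_mul_assoc)
  then have "matrix_inv A *v axis j 1 = (\<chi> k. det (\<chi> r s. if s = k then axis j 1 $ r else A $ r $ s) / det A)"
    using cramer[OF assms] by blast
  moreover have "(matrix_inv A *v axis j 1) $ i = matrix_inv A $ i $ j"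
    by (simp add: matrix_vector_mul_component inner_axis)
  ultimately show ?thesis by simp
qed

lemma C1_on_matrix_inv:
  fixes G :: "'d::euclidean_space \<Rightarrow> real ^ 'n ^ 'n"
  assumes "C1_on S G" and det: "\<And>y. y \<in> S \<Longrightarrow> det (G y) \<noteq> 0"
  shows "C1_on S (\<lambda>y. matrix_inv (G y) $ i $ j)"
proof (rule C1_on_cong)
  note comp = C1_on_matrix_component[OF assms(1)]
  have "C1_on S (\<lambda>y. det (\<chi> r s. if s = i then axis j 1 $ r else G y $ r $ s))"
  proof (rule C1_on_det)
    show "C1_on S (\<lambda>y. (\<chi> r s. if s = i then axis j 1 $ r else G y $ r $ s) $ r $ s)" for r s
      by (cases "s = i") (auto intro: comp)
  qed
  then show "C1_on S (\<lambda>y. det (\<chi> r s. if s = i then axis j 1 $ r else G y $ r $ s) / det (G y))"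
    by (rule C1_on_divide[OF _ C1_on_det[OF comp] det])
qed (use matrix_inv_cramer[OF det] in auto)

lemma pos_def_imp_det_nonzero:
  fixes A :: "real ^ 'n ^ 'n"
  assumes "\<And>v. v \<noteq> 0 \<Longrightarrow> 0 < v \<bullet> (A *v v)"
  shows "det A \<noteq> 0"
proof -
  have "inj ((*v) A)"
    unfolding linear_injective_0[OF matrix_vector_mul_linear]
    using assms by (metis inner_zero_right less_irrefl)
  then show ?thesis
    using det_nz_iff_inj[OF matrix_vector_mul_linear, of A] by simp
qed

lemma quadratic_form_sum:
  fixes A :: "real ^ 'n ^ 'n"
  shows "v \<bullet> (A *v v) = (\<Sum>i\<in>UNIV. \<Sum>j\<in>UNIV. A $ i $ j * v $ i * v $ j)"
  by (simp add: inner_vec_def matrix_vector_mult_def sum_distrib_left mult_ac)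

text \<open>Writing \<open>v\<close> as \<open>A *v u\<close> turns the form of the inverse at
  \<open>v\<close> into the form of \<open>A\<close> at \<open>u\<close>.\<close>

lemma pos_def_matrix_inv:
  fixes A :: "real ^ 'n ^ 'n"
  assumes pos: "\<And>v. v \<noteq> 0 \<Longrightarrow> 0 < v \<bullet> (A *v v)" and "v \<noteq> 0"
  shows "0 < v \<bullet> (matrix_inv A *v v)"
proof -
  define u where "u = matrix_inv A *v v"
  have v: "A *v u = v"
    using matrix_inv_right_left[OF pos_def_imp_det_nonzero[OF pos]]
    by (simp add: u_def matrix_vector_mul_assoc)
  with \<open>v \<noteq> 0\<close> have "u \<noteq> 0" by auto
  from pos[OF this] show ?thesis by (simp add: v inner_commute flip: u_def)
qed

lemma transpose_matrix_inv:
  fixes A :: "real ^ 'n ^ 'n"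
  assumes "det A \<noteq> 0" "transpose A = A"
  shows "transpose (matrix_inv A) = matrix_inv A"
proof -
  note inv = matrix_inv_right_left[OF assms(1)]
  have "transpose (matrix_inv A) ** A = mat 1"
    by (metis assms(2) inv(1) matrix_transpose_mul transpose_mat)
  then have "transpose (matrix_inv A) ** (A ** matrix_inv A) = matrix_inv A"
    by (simp add: matrix_mul_assoc)
  then show ?thesis by (simp add: inv(1))
qed

text \<open>From every point of the half-space, a small step in any positive coordinate direction
  stays inside; so difference quotients along the basis determine the derivative even at boundary
  points.\<close>

lemma has_derivative_unique_half_space:
  fixes S :: "(real ^ 'n::finite) set"
  assumes S: "openin (top_of_set half_space) S" "x \<in> S"
    and f: "(f has_derivative f') (at x within S)" "(f has_derivative f'') (at x within S)"
  shows "f' = f''"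
proof (rule frechet_derivative_unique_within[OF f])
  fix i :: "real ^ 'n" and e :: real
  assume i: "i \<in> Basis" and e: "0 < e"
  obtain r where r: "0 < r" "ball x r \<inter> half_space \<subseteq> S" using openin_half_space_ball[OF S] .
  define d where "d = min e r / 2"
  have d: "0 < d" "d < e" "d < r" using e r by (auto simp: d_def)
  obtain k where k: "i = axis k 1" using i by (auto simp: Basis_vec_def)
  have "x \<in> half_space" using S openin_imp_subset by blast
  then have "x + d *\<^sub>R i \<in> half_space" using d by (auto simp: k half_space_def axis_def)
  moreover have "x + d *\<^sub>R i \<in> ball x r" using d i by (simp add: dist_norm)
  ultimately show "\<exists>d. 0 < \<bar>d\<bar> \<and> \<bar>d\<bar> < e \<and> x + d *\<^sub>R i \<in> S" using d r by (intro exI[of _ d]) auto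
qed

text \<open>\<open>frechet_derivative\<close> is an arbitrary choice among derivatives; uniqueness
  identifies it with whichever derivative is at hand.\<close>

lemma partial_deriv_eq:
  assumes S: "openin (top_of_set half_space) S" "y \<in> S" and f: "(f has_derivative f') (at y within S)"
  shows "partial_deriv S i f y = f' (axis i 1)"
proof -
  have "(f has_derivative frechet_derivative f (at y within S)) (at y within S)"
    using f by (auto simp: frechet_derivative_works[symmetric] differentiable_def)
  from has_derivative_unique_half_space[OF S this f] show ?thesis
    by (simp add: partial_deriv_def)
qed

text \<open>The derivative families are explicit arguments so that the coordinate formula for the
  Laplacian can refer to them; \<open>F'' i\<close> is the derivative of the partial derivative in
  direction \<open>i\<close>.\<close>

definition twice_differentiable_on ::
  "'d::euclidean_space set \<Rightarrow> ('d \<Rightarrow> real) \<Rightarrow> ('d \<Rightarrow> 'd \<Rightarrow> real) \<Rightarrow> ('d \<Rightarrow> 'd \<Rightarrow> 'd \<Rightarrow> real) \<Rightarrow> bool"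
  where "twice_differentiable_on S F F' F'' \<longleftrightarrow>
    (\<forall>x\<in>S. (F has_derivative F' x) (at x within S) \<and>
      (\<forall>i\<in>Basis. ((\<lambda>y. F' y i) has_derivative F'' i x) (at x within S)))"

lemma twice_differentiable_onD:
  assumes "twice_differentiable_on S F F' F''" "x \<in> S"
  shows "(F has_derivative F' x) (at x within S)"
    and "i \<in> Basis \<Longrightarrow> ((\<lambda>y. F' y i) has_derivative F'' i x) (at x within S)"
  using assms by (simp_all add: twice_differentiable_on_def)

lemma Ck_Holder_on_2_twice_differentiable_on:
  assumes "Ck_Holder_on 2 \<alpha> S F"
  obtains F' F'' where "twice_differentiable_on S F F' F''"
proof -
  obtain F' where F': "\<forall>x\<in>S. (F has_derivative F' x) (at x within S)"
    "\<forall>i\<in>Basis. \<exists>F''. \<forall>x\<in>S. ((\<lambda>y. F' y i) has_derivative F'' x) (at x within S)"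
    using assms unfolding Ck_Holder_on_def numeral_2_eq_2 iterated_diff.simps by blast
  from bchoice[OF F'(2)] obtain F'' where
    "\<forall>i\<in>Basis. \<forall>x\<in>S. ((\<lambda>y. F' y i) has_derivative F'' i x) (at x within S)" by blast
  with F'(1) show thesis
    by (intro that[of F' F'']) (simp add: twice_differentiable_on_def)
qed

section \<open>The Laplace-Beltrami operator in nondivergence form\<close>

context riemannian_manifold_with_boundary
begin

lemma chart_inv_image: "c \<in> charts M \<Longrightarrow> x \<in> fst c \<Longrightarrow> chart_inv c (snd c x) = x"
  using chart_homeo[of c] by (auto simp: homeomorphism_def)

text \<open>Bundles what the half-space maximum principle asks of an operator. The last clause
  quantifies over all functions at once, so one pair of coefficients serves a whole linear
  combination.\<close>

definition laplacian_coefficients ::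
  "('a, 'n) chart \<Rightarrow> ('n \<Rightarrow> 'n \<Rightarrow> real ^ 'n \<Rightarrow> real) \<Rightarrow> ('n \<Rightarrow> real ^ 'n \<Rightarrow> real) \<Rightarrow> bool"
  where "laplacian_coefficients c A b \<longleftrightarrow>
    (\<forall>i j. continuous_on (chart_image c) (A i j)) \<and>
    (\<forall>j. continuous_on (chart_image c) (b j)) \<and>
    (\<forall>i j. \<forall>y\<in>chart_image c. A i j y = A j i y) \<and>
    (\<forall>y\<in>chart_image c. \<forall>v. v \<noteq> 0 \<longrightarrow> 0 < (\<Sum>i\<in>UNIV. \<Sum>j\<in>UNIV. A i j y * v $ i * v $ j)) \<and>
    (\<forall>u F' F'' x. twice_differentiable_on (chart_image c) (u \<circ> chart_inv c) F' F'' \<longrightarrow> x \<in> fst c \<longrightarrow>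
      laplace_beltrami M c u x =
        (\<Sum>i\<in>UNIV. \<Sum>j\<in>UNIV. A i j (snd c x) * F'' (axis j 1) (snd c x) (axis i 1)) +
        (\<Sum>j\<in>UNIV. b j (snd c x) * F' (snd c x) (axis j 1)))"

lemma laplacian_coefficientsD:
  assumes "laplacian_coefficients c A b"
  shows "continuous_on (chart_image c) (A i j)" "continuous_on (chart_image c) (b j)"
    and "y \<in> chart_image c \<Longrightarrow> A i j y = A j i y"
    and "y \<in> chart_image c \<Longrightarrow> v \<noteq> 0 \<Longrightarrow> 0 < (\<Sum>i\<in>UNIV. \<Sum>j\<in>UNIV. A i j y * v $ i * v $ j)"
    and "twice_differentiable_on (chart_image c) (u \<circ> chart_inv c) F' F'' \<Longrightarrow> x \<in> fst c \<Longrightarrow>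
      laplace_beltrami M c u x =
        (\<Sum>i\<in>UNIV. \<Sum>j\<in>UNIV. A i j (snd c x) * F'' (axis j 1) (snd c x) (axis i 1)) +
        (\<Sum>j\<in>UNIV. b j (snd c x) * F' (snd c x) (axis j 1))"
  using assms unfolding laplacian_coefficients_def by blast+

text \<open>The product rule applied to the divergence form: \<open>A\<close> is the inverse metric,
  and the derivatives falling on the weighted inverse metric form the drift
  \<open>b\<close>.\<close>

lemma laplacian_coefficients_exist:
  assumes c: "c \<in> charts M"
  obtains A b where "laplacian_coefficients c A b"
proof -
  let ?S = "chart_image c"
  note S = chart_image_open[OF c]
  define G where "G = metric M c \<circ> chart_inv c"
  have Gx: "G (snd c x) = metric M c x" if "x \<in> fst c" for x
    using chart_inv_image[OF c that] by (simp add: G_def)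
  have pos: "0 < v \<bullet> (G y *v v)" if "y \<in> ?S" "v \<noteq> 0" for y v
    using that metric_pos[OF c] by (auto simp: Gx)
  have sym: "transpose (G y) = G y" if "y \<in> ?S" for y
    using that metric_sym[OF c] by (auto simp: Gx)
  have det: "det (G y) \<noteq> 0" if "y \<in> ?S" for y
    using pos_def_imp_det_nonzero[OF pos[OF that]] .
  have C1G: "C1_on ?S G"
    unfolding G_def by (intro smooth_on_imp_C1_on metric_smooth c)
  define s where "s = (\<lambda>y. sqrt (det (G y)))"
  define A where "A = (\<lambda>i j y. matrix_inv (G y) $ i $ j)"
  have C1s: "C1_on ?S s"
    unfolding s_def by (intro C1_on_sqrt C1_on_det C1_on_matrix_component C1G det)
  have C1A: "C1_on ?S (A i j)" for i j
    unfolding A_def by (intro C1_on_matrix_inv C1G det)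
  have s0: "s y \<noteq> 0" if "y \<in> ?S" for y using det[OF that] by (simp add: s_def)
  have "C1_on ?S (\<lambda>y. s y * A i j y)" for i j by (intro C1_on_mult C1s C1A)
  then have "\<forall>i j. \<exists>B'. (\<forall>y\<in>?S. ((\<lambda>y. s y * A i j y) has_derivative B' y) (at y within ?S)) \<and>
      (\<forall>k\<in>Basis. continuous_on ?S (\<lambda>y. B' y k))"
    unfolding C1_on_def by blast
  then obtain B' where "\<forall>i j. (\<forall>y\<in>?S. ((\<lambda>y. s y * A i j y) has_derivative B' i j y) (at y within ?S)) \<and>
      (\<forall>k\<in>Basis. continuous_on ?S (\<lambda>y. B' i j y k))"
    unfolding choice_iff by blast
  then have B': "y \<in> ?S \<Longrightarrow> ((\<lambda>y. s y * A i j y) has_derivative B' i j y) (at y within ?S)"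
      "k \<in> Basis \<Longrightarrow> continuous_on ?S (\<lambda>y. B' i j y k)" for i j k y
    by blast+
  define b where "b = (\<lambda>j y. (\<Sum>i\<in>UNIV. B' i j y (axis i 1)) / s y)"
  have "laplacian_coefficients c A b"
    unfolding laplacian_coefficients_def
  proof (intro conjI allI ballI impI)
    show "continuous_on ?S (A i j)" for i j by (rule C1_on_imp_continuous_on[OF C1A])
    show "continuous_on ?S (b j)" for j unfolding b_def
      by (intro continuous_on_divide continuous_on_sum B'(2) C1_on_imp_continuous_on[OF C1s]) (auto simp: s0)
    show "A i j y = A j i y" if "y \<in> ?S" for i j y
      using arg_cong[OF transpose_matrix_inv[OF det[OF that] sym[OF that]], of "\<lambda>B. B $ j $ i"]
      by (simp add: A_def transpose_def)
    show "0 < (\<Sum>i\<in>UNIV. \<Sum>j\<in>UNIV. A i j y * v $ i * v $ j)" if "y \<in> ?S" "v \<noteq> 0" for y v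
      using pos_def_matrix_inv[OF pos[OF that(1)] that(2)] unfolding A_def quadratic_form_sum .
    fix u F' F'' x
    assume F: "twice_differentiable_on ?S (u \<circ> chart_inv c) F' F''" and x: "x \<in> fst c"
    define y where "y = snd c x"
    have y: "y \<in> ?S" using x by (simp add: y_def)
    have pd: "partial_deriv ?S j (u \<circ> chart_inv c) t = F' t (axis j 1)" if "t \<in> ?S" for t j
      by (rule partial_deriv_eq[OF S that twice_differentiable_onD(1)[OF F that]])
    \<comment> \<open>The inner \<open>partial_deriv\<close> is known to equal \<open>F'\<close>
      only on the chart image, which suffices because the outer derivative is taken within that
      set.\<close>
    have term_eq: "partial_deriv ?S i (\<lambda>t. sqrt (det (G t)) * matrix_inv (G t) $ i $ j * partial_deriv ?S j (u \<circ> chart_inv c) t) y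
       = s y * A i j y * F'' (axis j 1) y (axis i 1) + B' i j y (axis i 1) * F' y (axis j 1)" for i j
    proof (rule partial_deriv_eq[OF S y])
      have "((\<lambda>t. F' t (axis j 1)) has_derivative F'' (axis j 1) y) (at y within ?S)"
        using twice_differentiable_onD(2)[OF F y] by simp
      from has_derivative_mult[OF B'(1)[OF y, of i j] this]
      show "((\<lambda>t. sqrt (det (G t)) * matrix_inv (G t) $ i $ j * partial_deriv ?S j (u \<circ> chart_inv c) t)
        has_derivative (\<lambda>h. s y * A i j y * F'' (axis j 1) y h + B' i j y h * F' y (axis j 1))) (at y within ?S)"
        by (rule has_derivative_transform[OF y, rotated]) (simp add: pd s_def A_def)
    qed
    have "laplace_beltrami M c u x =
      (\<Sum>i\<in>UNIV. \<Sum>j\<in>UNIV. s y * A i j y * F'' (axis j 1) y (axis i 1) + B' i j y (axis i 1) * F' y (axis j 1)) / s y"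
      unfolding laplace_beltrami_def Let_def G_def[symmetric] y_def[symmetric] term_eq
      by (simp add: s_def y_def Gx[OF x])
    also have "\<dots> = (\<Sum>i\<in>UNIV. \<Sum>j\<in>UNIV. A i j y * F'' (axis j 1) y (axis i 1)
        + B' i j y (axis i 1) / s y * F' y (axis j 1))"
      unfolding sum_divide_distrib using s0[OF y] by (intro sum.cong refl) (simp add: field_simps)
    also have "\<dots> = (\<Sum>i\<in>UNIV. \<Sum>j\<in>UNIV. A i j y * F'' (axis j 1) y (axis i 1)) +
        (\<Sum>i\<in>UNIV. \<Sum>j\<in>UNIV. B' i j y (axis i 1) / s y * F' y (axis j 1))"
      by (simp add: sum.distrib)
    also have "(\<Sum>i\<in>UNIV. \<Sum>j\<in>UNIV. B' i j y (axis i 1) / s y * F' y (axis j 1)) =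
        (\<Sum>j\<in>UNIV. b j y * F' y (axis j 1))"
      by (subst sum.swap) (simp add: b_def sum_divide_distrib sum_distrib_right)
    finally show "laplace_beltrami M c u x =
        (\<Sum>i\<in>UNIV. \<Sum>j\<in>UNIV. A i j (snd c x) * F'' (axis j 1) (snd c x) (axis i 1)) +
        (\<Sum>j\<in>UNIV. b j (snd c x) * F' (snd c x) (axis j 1))"
      by (simp add: y_def)
  qed
  then show thesis by (rule that)
qed

end


section \<open>Maximum principles on the manifold\<close>

lemma twice_differentiable_on_lincomb:
  assumes "twice_differentiable_on S F F' F''" "twice_differentiable_on S G G' G''"
  shows "twice_differentiable_on S (\<lambda>x. s * F x + t * G x) (\<lambda>x v. s * F' x v + t * G' x v)
    (\<lambda>i x v. s * F'' i x v + t * G'' i x v)"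
  using assms unfolding twice_differentiable_on_def
  by (auto intro!: derivative_intros)

lemma twice_differentiable_on_const:
  "twice_differentiable_on S (\<lambda>_. k) (\<lambda>_ _. 0) (\<lambda>_ _ _. 0)"
  by (simp add: twice_differentiable_on_def)

text \<open>Orthogonality to the hyperplane forces \<open>G *v N\<close> to be a multiple of
  \<open>axis k 1\<close>, hence \<open>N\<close> a multiple of \<open>n\<close>; the length and the
  sign then fix the factor. This is what makes the description of
  \<open>exterior_unit_normal\<close> definite.\<close>

lemma ex1_unit_normal:
  fixes G :: "real ^ 'n ^ 'n"
  assumes sym: "transpose G = G" and pos: "\<And>v. v \<noteq> 0 \<Longrightarrow> 0 < v \<bullet> (G *v v)"
  shows "\<exists>!N. N \<bullet> (G *v N) = 1 \<and> (\<forall>v. v $ k = 0 \<longrightarrow> N \<bullet> (G *v v) = 0) \<and> N $ k < 0"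
proof -
  have G_sym: "x \<bullet> (G *v y) = (G *v x) \<bullet> y" for x y
    using dot_lmul_matrix[of x G y] transpose_matrix_vector[of G x] by (simp add: sym)
  note inv = matrix_inv_right_left[OF pos_def_imp_det_nonzero[OF pos]]
  define n where "n = matrix_inv G *v axis k 1"
  have Gn: "G *v n = axis k 1" by (simp add: n_def matrix_vector_mul_assoc inv)
  have "n \<noteq> 0"
  proof
    assume "n = 0"
    then have "axis k 1 = (0 :: real ^ 'n)" using Gn by simp
    then show False by simp
  qed
  define q where "q = n $ k"
  have "n \<bullet> (G *v n) = q" by (simp add: Gn inner_axis q_def)
  with pos[OF \<open>n \<noteq> 0\<close>] have q: "0 < q" by simp
  \<comment> \<open>\<open>q\<close> is the squared length of \<open>n\<close> and also its
    \<open>k\<close>-th component, so this factor normalizes \<open>n\<close> and makes the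
    component negative.\<close>
  define r where "r = - 1 / sqrt q"
  have r: "r < 0" "r * r * q = 1" using q by (simp_all add: r_def)
  show ?thesis
  proof (rule ex1I[of _ "r *\<^sub>R n"])
    show "(r *\<^sub>R n) \<bullet> (G *v (r *\<^sub>R n)) = 1 \<and>
        (\<forall>v. v $ k = 0 \<longrightarrow> (r *\<^sub>R n) \<bullet> (G *v v) = 0) \<and> (r *\<^sub>R n) $ k < 0"
      using r q unfolding G_sym
      by (auto simp: matrix_vector_mult_scaleR Gn inner_axis' mult_neg_pos mult.assoc simp flip: q_def)
  next
    fix N assume N: "N \<bullet> (G *v N) = 1 \<and> (\<forall>v. v $ k = 0 \<longrightarrow> N \<bullet> (G *v v) = 0) \<and> N $ k < 0"
    define t where "t = (G *v N) $ k"
    have "(G *v N) $ i = 0" if "i \<noteq> k" for i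
    proof -
      have "N \<bullet> (G *v axis i 1) = 0" using N that by (auto simp: axis_def)
      then show ?thesis unfolding G_sym by (simp add: inner_axis)
    qed
    then have GN: "G *v N = t *\<^sub>R axis k 1" by (auto simp: vec_eq_iff t_def axis_def)
    have "N = matrix_inv G *v (G *v N)" by (simp add: matrix_vector_mul_assoc inv)
    also have "\<dots> = t *\<^sub>R n" by (simp add: GN matrix_vector_mult_scaleR n_def)
    finally have Nt: "N = t *\<^sub>R n" .
    have "t * t * q = 1" using N unfolding GN by (simp add: Nt inner_axis q_def mult.assoc)
    then have "t * t = r * r" using r q by (metis mult_right_cancel less_irrefl)
    moreover have "t < 0" using N q by (simp add: Nt q_def mult_less_0_iff)
    ultimately have "t = r" using r(1) by (simp add: square_eq_iff)
    then show "N = r *\<^sub>R n" using Nt by simp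
  qed
qed

section \<open>Linearity and locality of the Laplacian, then maximum principles by
  connectedness\<close>

context riemannian_manifold_with_boundary
begin

definition twice_differentiable :: "('a \<Rightarrow> real) \<Rightarrow> bool"
  where "twice_differentiable u \<longleftrightarrow>
    (\<forall>c\<in>charts M. \<exists>F' F''. twice_differentiable_on (chart_image c) (u \<circ> chart_inv c) F' F'')"

lemma twice_differentiableE:
  assumes "twice_differentiable u" "c \<in> charts M"
  obtains F' F'' where "twice_differentiable_on (chart_image c) (u \<circ> chart_inv c) F' F''"
  using assms unfolding twice_differentiable_def by blast

lemma Holder_space_twice_differentiable: "u \<in> Holder_space M 2 \<alpha> \<Longrightarrow> twice_differentiable u"
  unfolding Holder_space_def twice_differentiable_def
  by (blast elim: Ck_Holder_on_2_twice_differentiable_on)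

lemma twice_differentiable_lincomb:
  assumes "twice_differentiable u" "twice_differentiable v"
  shows "twice_differentiable (\<lambda>x. s * u x + t * v x)"
  unfolding twice_differentiable_def
proof
  fix c assume c: "c \<in> charts M"
  obtain F' F'' where F: "twice_differentiable_on (chart_image c) (u \<circ> chart_inv c) F' F''"
    using twice_differentiableE[OF assms(1) c] .
  obtain G' G'' where G: "twice_differentiable_on (chart_image c) (v \<circ> chart_inv c) G' G''"
    using twice_differentiableE[OF assms(2) c] .
  from twice_differentiable_on_lincomb[OF F G, of s t]
  show "\<exists>F' F''. twice_differentiable_on (chart_image c) ((\<lambda>x. s * u x + t * v x) \<circ> chart_inv c) F' F''"
    by (intro exI) (simp add: o_def)
qed

lemma laplace_beltrami_lincomb:
  assumes "twice_differentiable u" "twice_differentiable v" and c: "c \<in> charts M" and x: "x \<in> fst c"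
  shows "laplace_beltrami M c (\<lambda>x. s * u x + t * v x) x =
    s * laplace_beltrami M c u x + t * laplace_beltrami M c v x"
proof -
  obtain F' F'' where F: "twice_differentiable_on (chart_image c) (u \<circ> chart_inv c) F' F''"
    using twice_differentiableE[OF assms(1) c] .
  obtain G' G'' where G: "twice_differentiable_on (chart_image c) (v \<circ> chart_inv c) G' G''"
    using twice_differentiableE[OF assms(2) c] .
  have "twice_differentiable_on (chart_image c) ((\<lambda>x. s * u x + t * v x) \<circ> chart_inv c)
      (\<lambda>x v. s * F' x v + t * G' x v) (\<lambda>i x v. s * F'' i x v + t * G'' i x v)"
    using twice_differentiable_on_lincomb[OF F G, of s t] by (simp add: o_def)
  note FG = F G this
  obtain A b where "laplacian_coefficients c A b" using laplacian_coefficients_exist[OF c] .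
  note L = laplacian_coefficientsD(5)[OF this _ x]
  show ?thesis
    unfolding L[OF FG(1)] L[OF FG(2)] L[OF FG(3)]
    by (simp add: sum_distrib_left sum.distrib algebra_simps)
qed

lemma laplace_beltrami_const:
  assumes c: "c \<in> charts M" and x: "x \<in> fst c"
  shows "laplace_beltrami M c (\<lambda>_. k) x = 0"
proof -
  obtain A b where "laplacian_coefficients c A b" using laplacian_coefficients_exist[OF c] .
  note L = laplacian_coefficientsD(5)[OF this _ x]
  have "twice_differentiable_on (chart_image c) ((\<lambda>_. k) \<circ> chart_inv c) (\<lambda>_ _. 0) (\<lambda>_ _ _. 0)"
    unfolding o_def by (rule twice_differentiable_on_const)
  from L[OF this] show ?thesis by simp
qed

text \<open>The operator sees a function only through the inverse chart on the chart image. This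
  matters because the maximum principle yields constancy on \<open>points M\<close> and says nothing
  outside.\<close>

lemma laplace_beltrami_cong:
  assumes u: "twice_differentiable u" and eq: "\<And>x. x \<in> points M \<Longrightarrow> v x = u x"
    and c: "c \<in> charts M" and x: "x \<in> fst c"
  shows "laplace_beltrami M c v x = laplace_beltrami M c u x"
proof -
  obtain F' F'' where F: "twice_differentiable_on (chart_image c) (u \<circ> chart_inv c) F' F''"
    using twice_differentiableE[OF u c] .
  have "(v \<circ> chart_inv c) y = (u \<circ> chart_inv c) y" if "y \<in> chart_image c" for y
  proof -
    from that obtain x where x: "x \<in> fst c" "y = snd c x" by blast
    then have "x \<in> points M" using charts_cover c by blast
    with eq x show ?thesis by (simp add: chart_inv_image[OF c])
  qed
  then have G: "twice_differentiable_on (chart_image c) (v \<circ> chart_inv c) F' F''"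
    using twice_differentiable_onD[OF F] unfolding twice_differentiable_on_def
    by (intro ballI conjI) (rule has_derivative_transform[where f = "u \<circ> chart_inv c"])
  obtain A b where "laplacian_coefficients c A b" using laplacian_coefficients_exist[OF c] .
  note L = laplacian_coefficientsD(5)[OF this _ x]
  show ?thesis unfolding L[OF F] L[OF G] ..
qed

lemma boundary_subset: "boundary M \<subseteq> points M"
  using charts_cover by (auto simp: boundary_def)

lemma chart_subset: "c \<in> charts M \<Longrightarrow> fst c \<subseteq> points M"
  using charts_cover by auto

lemma obtain_chart:
  assumes "p \<in> points M"
  obtains c where "c \<in> charts M" "p \<in> fst c"
  using assms charts_cover by blast

lemma chart_continuous: "c \<in> charts M \<Longrightarrow> continuous_on (fst c) (snd c)"
  using chart_homeo homeomorphism_cont1 by blast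

lemma twice_differentiable_continuous_on:
  assumes u: "twice_differentiable u"
  shows "continuous_on (points M) u"
  unfolding continuous_on_eq_continuous_within
proof
  fix p assume "p \<in> points M"
  then obtain c where c: "c \<in> charts M" "p \<in> fst c" by (rule obtain_chart)
  obtain F' F'' where F: "twice_differentiable_on (chart_image c) (u \<circ> chart_inv c) F' F''"
    using twice_differentiableE[OF u c(1)] .
  have "continuous_on (chart_image c) (u \<circ> chart_inv c)"
    using has_derivative_continuous[OF twice_differentiable_onD(1)[OF F]]
    unfolding continuous_on_eq_continuous_within by blast
  from continuous_on_compose[OF chart_continuous[OF c(1)] this]
  have "continuous_on (fst c) u"
    by (rule continuous_on_eq) (simp add: chart_inv_image[OF c(1)])
  moreover obtain T where "open T" "fst c = points M \<inter> T"
    using chart_dom_open[OF c(1)] by (auto simp: openin_open)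
  ultimately show "continuous (at p within points M) u"
    using c at_within_nhd[of p T "points M" "fst c"]
    by (auto simp: continuous_on_eq_continuous_within)
qed

text \<open>The set of maximum points is closed by continuity and open by the half-space result.
  \<open>loc\<close> lets each maximum point pick its chart and neighbourhood: the minimum principle
  knows the sign of the Laplacian only near the minimum set, and a condition on the normal
  derivative is available only in the chart that \<open>normal_deriv\<close> selects.\<close>

lemma strong_maximum:
  assumes conn: "connected (points M)" and w: "twice_differentiable w"
    and le: "\<And>x. x \<in> points M \<Longrightarrow> w x \<le> m" and p0: "p0 \<in> points M" "w p0 = m"
    and loc: "\<And>p. p \<in> points M \<Longrightarrow> w p = m \<Longrightarrow>
      \<exists>c\<in>charts M. \<exists>U. p \<in> fst c \<and> openin (top_of_set (points M)) U \<and> p \<in> U \<and>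
        (\<forall>x\<in>U \<inter> fst c. 0 \<le> laplace_beltrami M c w x) \<and>
        (snd c p $ bdry_coord = 0 \<longrightarrow>
          (\<exists>D N. (w \<circ> chart_inv c has_derivative D) (at (snd c p) within chart_image c) \<and>
            D N = 0 \<and> N $ bdry_coord < 0))"
    and x: "x \<in> points M"
  shows "w x = m"
proof -
  define Z where "Z = {x \<in> points M. w x = m}"
  have "closedin (top_of_set (points M)) Z"
    unfolding Z_def
    by (intro continuous_closedin_preimage_constant twice_differentiable_continuous_on w)
  moreover have "openin (top_of_set (points M)) Z"
  proof (subst openin_subopen, intro ballI)
    fix p assume "p \<in> Z"
    then have p: "p \<in> points M" "w p = m" by (auto simp: Z_def)
    from loc[OF p] obtain c U where c: "c \<in> charts M" "p \<in> fst c"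
      and U: "openin (top_of_set (points M)) U" "p \<in> U"
      and sub: "\<forall>x\<in>U \<inter> fst c. 0 \<le> laplace_beltrami M c w x"
      and bd: "snd c p $ bdry_coord = 0 \<longrightarrow>
          (\<exists>D N. (w \<circ> chart_inv c has_derivative D) (at (snd c p) within chart_image c) \<and>
            D N = 0 \<and> N $ bdry_coord < 0)"
      by (elim bexE exE conjE) (rule that)
    obtain F' F'' where F: "twice_differentiable_on (chart_image c) (w \<circ> chart_inv c) F' F''"
      using twice_differentiableE[OF w c(1)] .
    define V where "V = fst c \<inter> U"
    have V: "openin (top_of_set (points M)) V" "V \<subseteq> fst c" "p \<in> V"
      using chart_dom_open[OF c(1)] U c by (auto simp: V_def)
    define S where "S = snd c ` V"
    have "openin (top_of_set (fst c)) V"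
      using V chart_subset[OF c(1)] by (meson openin_subset_trans)
    then have "openin (top_of_set (chart_image c)) S"
      unfolding S_def by (rule homeomorphism_imp_open_map[OF chart_homeo[OF c(1)]])
    then have S: "openin (top_of_set half_space) S"
      using chart_image_open[OF c(1)] by (rule openin_trans)
    have Sc: "S \<subseteq> chart_image c" using V by (auto simp: S_def)
    have winv: "(w \<circ> chart_inv c) (snd c x) = w x" if "x \<in> V" for x
      using chart_inv_image[OF c(1)] that V by auto
    obtain A b where AB: "laplacian_coefficients c A b" using laplacian_coefficients_exist[OF c(1)] .
    have "\<exists>e>0. \<forall>y\<in>S \<inter> ball (snd c p) e. (w \<circ> chart_inv c) y = m"
    proof (rule half_space_strong_maximum[OF S, where A = A and b = b and w' = F' and w'' = "\<lambda>j. F'' (axis j 1)"])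
      show "(w \<circ> chart_inv c has_derivative F' y) (at y within S)" if "y \<in> S" for y
        by (rule has_derivative_subset[OF twice_differentiable_onD(1)[OF F subsetD[OF Sc that]] Sc])
      show "((\<lambda>x. F' x (axis j 1)) has_derivative F'' (axis j 1) y) (at y within S)" if "y \<in> S" for y j
        by (rule has_derivative_subset[OF twice_differentiable_onD(2)[OF F subsetD[OF Sc that]] Sc]) simp
      show "0 \<le> (\<Sum>i\<in>UNIV. \<Sum>j\<in>UNIV. A i j y * F'' (axis j 1) y (axis i 1)) + (\<Sum>j\<in>UNIV. b j y * F' y (axis j 1))"
        if y: "y \<in> S" for y
      proof -
        obtain x where x: "x \<in> V" "y = snd c x" using y by (auto simp: S_def)
        then have "x \<in> fst c" "0 \<le> laplace_beltrami M c w x" using sub by (auto simp: V_def)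
        with laplacian_coefficientsD(5)[OF AB F] x(2) show ?thesis by simp
      qed
      show "(w \<circ> chart_inv c) y \<le> m" if y: "y \<in> S" for y
      proof -
        obtain x where x: "x \<in> V" "y = snd c x" using y by (auto simp: S_def)
        then have "x \<in> points M" using V(2) chart_subset[OF c(1)] by blast
        then show ?thesis unfolding x(2) winv[OF x(1)] by (rule le)
      qed
      show "snd c p \<in> S" using V by (simp add: S_def)
      show "(w \<circ> chart_inv c) (snd c p) = m" using winv V(3) p by simp
      show "\<exists>N. F' (snd c p) N = 0 \<and> N $ bdry_coord < 0" if b0: "snd c p $ bdry_coord = 0"
      proof -
        obtain D N where D: "(w \<circ> chart_inv c has_derivative D) (at (snd c p) within chart_image c)"
          "D N = 0" "N $ bdry_coord < 0"
          using bd[rule_format, OF b0] by (elim exE conjE) (rule that)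
        have pc: "snd c p \<in> chart_image c" using c by auto
        \<comment> \<open>The derivative supplied by \<open>loc\<close> need not be the chosen
          family \<open>F'\<close>; uniqueness on the half-space transfers the condition on
          \<open>N\<close>.\<close>
        have "D = F' (snd c p)"
          by (rule has_derivative_unique_half_space[OF chart_image_open[OF c(1)] pc D(1)
              twice_differentiable_onD(1)[OF F pc]])
        with D(2,3) show ?thesis by (intro exI[of _ N]) simp
      qed
      show "continuous_on S (A i j)" "continuous_on S (b j)" for i j
        by (rule continuous_on_subset[OF laplacian_coefficientsD(1)[OF AB] Sc]
            continuous_on_subset[OF laplacian_coefficientsD(2)[OF AB] Sc])+
      show "A i j y = A j i y" if "y \<in> S" for i j y
        by (rule laplacian_coefficientsD(3)[OF AB subsetD[OF Sc that]])
      show "0 < (\<Sum>i\<in>UNIV. \<Sum>j\<in>UNIV. A i j y * v $ i * v $ j)" if "y \<in> S" "v \<noteq> 0" for y v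
        by (rule laplacian_coefficientsD(4)[OF AB subsetD[OF Sc that(1)] that(2)])
    qed
    then obtain e where e: "0 < e" "\<And>y. y \<in> S \<Longrightarrow> y \<in> ball (snd c p) e \<Longrightarrow> (w \<circ> chart_inv c) y = m"
      by (elim exE conjE) (rule that, auto)
    define Q where "Q = V \<inter> snd c -` ball (snd c p) e"
    have "openin (top_of_set V) Q"
      unfolding Q_def
      by (rule continuous_openin_preimage_gen[OF continuous_on_subset[OF chart_continuous[OF c(1)] V(2)]]) auto
    then have "openin (top_of_set (points M)) Q" using V(1) by (rule openin_trans)
    moreover have "p \<in> Q" using V e by (auto simp: Q_def)
    moreover have "Q \<subseteq> Z"
    proof
      fix x assume x: "x \<in> Q"
      then have "(w \<circ> chart_inv c) (snd c x) = m" by (intro e) (auto simp: Q_def S_def)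
      then show "x \<in> Z" using x V winv[of x] chart_subset[OF c(1)] by (auto simp: Z_def Q_def)
    qed
    ultimately show "\<exists>T. openin (top_of_set (points M)) T \<and> p \<in> T \<and> T \<subseteq> Z" by blast
  qed
  moreover have "Z \<noteq> {}" using p0 by (auto simp: Z_def)
  ultimately have "Z = points M" using conn by (auto simp: connected_clopen)
  then show ?thesis using x by (auto simp: Z_def)
qed

text \<open>A minimum below \<open>k\<close> is not attained on the boundary, and around each
  minimum point the open set \<open>U\<close> carries the inequality. The strong maximum principle
  for \<open>- w\<close> then makes \<open>w\<close> constant, against its value at a boundary
  point. Asking for \<open>sup\<close> only below \<open>k\<close> is what allows the nonlinear
  equation, where the sign of the right-hand side depends on the solution.\<close>

lemma minimum_principle:
  assumes comp: "compact (points M)" and conn: "connected (points M)" and ne: "boundary M \<noteq> {}"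
    and w: "twice_differentiable w"
    and bd: "\<And>x. x \<in> boundary M \<Longrightarrow> k \<le> w x"
    and sup: "\<And>c x. c \<in> charts M \<Longrightarrow> x \<in> fst c \<Longrightarrow> w x < k \<Longrightarrow> laplace_beltrami M c w x \<le> 0"
    and x: "x \<in> points M"
  shows "k \<le> w x"
proof (rule ccontr)
  assume "\<not> k \<le> w x"
  have cont: "continuous_on (points M) w" by (rule twice_differentiable_continuous_on[OF w])
  obtain p0 where p0: "p0 \<in> points M" "\<And>y. y \<in> points M \<Longrightarrow> w p0 \<le> w y"
    using continuous_attains_inf[OF comp _ cont] x by blast
  have lt: "w p0 < k" using p0(2)[OF x] \<open>\<not> k \<le> w x\<close> by simp
  define U where "U = points M \<inter> w -` {..<k}"
  have U: "openin (top_of_set (points M)) U"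
    unfolding U_def by (rule continuous_openin_preimage_gen[OF cont]) auto
  have tw: "twice_differentiable (\<lambda>x. - w x)"
    using twice_differentiable_lincomb[OF w w, of "-1" 0] by simp
  obtain y where y: "y \<in> boundary M" using ne by blast
  have "- w y = - w p0"
  proof (rule strong_maximum[OF conn tw])
    fix p assume p: "p \<in> points M" "- w p = - w p0"
    then have "w p < k" using lt by simp
    then have "p \<notin> boundary M" using bd by (meson not_le)
    obtain c where c: "c \<in> charts M" "p \<in> fst c" using p obtain_chart by metis
    have "snd c p $ bdry_coord \<noteq> 0" using \<open>p \<notin> boundary M\<close> c by (auto simp: boundary_def)
    moreover have "0 \<le> laplace_beltrami M c (\<lambda>x. - w x) x" if "x \<in> U \<inter> fst c" for x
      using laplace_beltrami_lincomb[OF w w c(1), of x "-1" 0] sup[OF c(1), of x] that by (auto simp: U_def)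
    moreover have "p \<in> U" using p \<open>w p < k\<close> by (auto simp: U_def)
    ultimately show "\<exists>c\<in>charts M. \<exists>U. p \<in> fst c \<and> openin (top_of_set (points M)) U \<and> p \<in> U \<and>
        (\<forall>x\<in>U \<inter> fst c. 0 \<le> laplace_beltrami M c (\<lambda>x. - w x) x) \<and>
        (snd c p $ bdry_coord = 0 \<longrightarrow>
          (\<exists>D N. ((\<lambda>x. - w x) \<circ> chart_inv c has_derivative D) (at (snd c p) within chart_image c) \<and>
            D N = 0 \<and> N $ bdry_coord < 0))"
      using c U by blast
  qed (use p0 y boundary_subset in auto)
  then show False using lt bd[OF y] by simp
qed

lemma exterior_unit_normal_points_outward:
  assumes "c \<in> charts M" "p \<in> fst c"
  shows "exterior_unit_normal M c p $ bdry_coord < 0"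
  using theI'[OF ex1_unit_normal[OF metric_sym[OF assms] metric_pos[OF assms], of bdry_coord]]
  unfolding exterior_unit_normal_def by blast

text \<open>Both normal derivatives are read in the same selected chart with the same normal vector,
  so equality becomes the vanishing of one derivative of the difference. The factor \<open>s\<close>
  will be the sign \<sigma>.\<close>

lemma normal_deriv_eq_imp:
  assumes u: "twice_differentiable u" and v: "twice_differentiable v"
    and p: "p \<in> boundary M" and eq: "normal_deriv M u p = normal_deriv M v p"
  obtains c D N where "c \<in> charts M" "p \<in> fst c"
    "((\<lambda>x. s * u x - s * v x) \<circ> chart_inv c has_derivative D) (at (snd c p) within chart_image c)"
    "D N = 0" "N $ bdry_coord < 0"
proof -
  define c where "c = (SOME c. c \<in> charts M \<and> p \<in> fst c)"
  have "\<exists>c. c \<in> charts M \<and> p \<in> fst c" using p by (auto simp: boundary_def)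
  from someI_ex[OF this] have c: "c \<in> charts M" "p \<in> fst c" by (auto simp: c_def)
  define N where "N = exterior_unit_normal M c p"
  define D where "D = (\<lambda>u :: 'a \<Rightarrow> real. frechet_derivative (u \<circ> chart_inv c) (at (snd c p) within chart_image c))"
  have eqD: "D u N = D v N"
    using eq by (simp add: normal_deriv_def Let_def N_def D_def flip: c_def)
  have D: "(w \<circ> chart_inv c has_derivative D w) (at (snd c p) within chart_image c)"
    if w: "twice_differentiable w" for w
  proof -
    obtain F' F'' where F: "twice_differentiable_on (chart_image c) (w \<circ> chart_inv c) F' F''"
      using twice_differentiableE[OF w c(1)] .
    from twice_differentiable_onD(1)[OF F, of "snd c p"] c
    show ?thesis unfolding D_def by (auto simp: frechet_derivative_works[symmetric] differentiable_def)
  qed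
  have "((\<lambda>x. s * u x - s * v x) \<circ> chart_inv c has_derivative (\<lambda>h. s * D u h - s * D v h))
      (at (snd c p) within chart_image c)"
    using D[OF u] D[OF v] by (auto simp: o_def intro!: derivative_intros)
  from that[OF c this, of N] show thesis
    using eqD exterior_unit_normal_points_outward[OF c] by (simp add: N_def)
qed

end


section \<open>The Dirichlet-to-Neumann map\<close>

context riemannian_manifold_with_boundary
begin

lemma dirichlet_solutionD:
  assumes "dirichlet_solution M \<alpha> a f u"
  shows "twice_differentiable u"
    and "c \<in> charts M \<Longrightarrow> x \<in> fst c \<Longrightarrow> laplace_beltrami M c u x = a x (u x)"
    and "x \<in> boundary M \<Longrightarrow> u x = f x"
  using assms Holder_space_twice_differentiable unfolding dirichlet_solution_def by force+

text \<open>The sign \<sigma> treats positive and negative data together. \<open>K\<close> is a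
  lower bound for the boundary values; it reaches the interior only at the end, after
  \<open>a0\<close> has shown that \<open>u\<close> is harmonic.\<close>

lemma same_normal_derivative_rigidity:
  assumes comp: "compact (points M)" and conn: "connected (points M)" and ne: "boundary M \<noteq> {}"
    and \<sigma>: "\<sigma> = 1 \<or> \<sigma> = - 1"
    and mono: "\<And>x s t. x \<in> points M \<Longrightarrow> s \<le> t \<Longrightarrow> a x s \<le> a x t"
    and zero: "\<And>x. x \<in> points M \<Longrightarrow> a x 0 = 0"
    and u: "twice_differentiable u" and v: "twice_differentiable v"
    and Lu: "\<And>c x. c \<in> charts M \<Longrightarrow> x \<in> fst c \<Longrightarrow> laplace_beltrami M c u x = a x (u x)"
    and Lv: "\<And>c x. c \<in> charts M \<Longrightarrow> x \<in> fst c \<Longrightarrow> laplace_beltrami M c v x = 0"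
    and nd: "\<And>p. p \<in> boundary M \<Longrightarrow> normal_deriv M u p = normal_deriv M v p"
    and bd: "\<And>x. x \<in> boundary M \<Longrightarrow> K \<le> \<sigma> * u x" and K: "0 \<le> K"
  shows "\<exists>k. \<forall>x\<in>points M. u x - v x = k"
    and "\<forall>x\<in>points M. a x (u x) = 0 \<and> K \<le> \<sigma> * u x"
proof -
  have \<sigma>2: "\<sigma> * (\<sigma> * t) = t" for t using \<sigma> by auto
  have sign: "0 \<le> \<sigma> * a x t" if "0 \<le> \<sigma> * t" "x \<in> points M" for x t
    using mono[OF that(2), of 0 t] mono[OF that(2), of t 0] zero[OF that(2)] that(1) \<sigma> by auto
  have sign': "\<sigma> * a x t \<le> 0" if "\<sigma> * t \<le> 0" "x \<in> points M" for x t
    using mono[OF that(2), of 0 t] mono[OF that(2), of t 0] zero[OF that(2)] that(1) \<sigma> by auto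
  have tu: "twice_differentiable (\<lambda>x. \<sigma> * u x)"
    using twice_differentiable_lincomb[OF u u, of \<sigma> 0] by simp
  have Ltu: "laplace_beltrami M c (\<lambda>x. \<sigma> * u x) x = \<sigma> * a x (u x)" if "c \<in> charts M" "x \<in> fst c" for c x
    using laplace_beltrami_lincomb[OF u u that, of \<sigma> 0] Lu[OF that] by simp
  have pos: "0 \<le> \<sigma> * u x" if "x \<in> points M" for x
  proof (rule minimum_principle[OF comp conn ne tu _ _ that])
    show "0 \<le> \<sigma> * u x" if "x \<in> boundary M" for x using bd[OF that] K by simp
    show "laplace_beltrami M c (\<lambda>x. \<sigma> * u x) x \<le> 0" if "c \<in> charts M" "x \<in> fst c" "\<sigma> * u x < 0" for c x
      unfolding Ltu[OF that(1,2)] using that chart_subset[OF that(1)] by (intro sign') auto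
  qed
  define w where "w = (\<lambda>x. \<sigma> * u x - \<sigma> * v x)"
  have w: "twice_differentiable w"
    using twice_differentiable_lincomb[OF u v, of \<sigma> "-\<sigma>"] by (simp add: w_def)
  have Lw: "laplace_beltrami M c w x = \<sigma> * a x (u x)" if "c \<in> charts M" "x \<in> fst c" for c x
    using laplace_beltrami_lincomb[OF u v that, of \<sigma> "-\<sigma>"] Lu[OF that] Lv[OF that] by (simp add: w_def)
  have Lw0: "0 \<le> laplace_beltrami M c w x" if "c \<in> charts M" "x \<in> fst c" for c x
    unfolding Lw[OF that] using that chart_subset[OF that(1)] by (intro sign pos) auto
  have "points M \<noteq> {}" using ne boundary_subset by auto
  then obtain p0 where p0: "p0 \<in> points M" "\<And>x. x \<in> points M \<Longrightarrow> w x \<le> w p0"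
    using continuous_attains_sup[OF comp _ twice_differentiable_continuous_on[OF w]] by blast
  have const: "w x = w p0" if "x \<in> points M" for x
  proof (rule strong_maximum[OF conn w p0(2) p0(1) refl _ that])
    fix p assume p: "p \<in> points M"
    show "\<exists>c\<in>charts M. \<exists>U. p \<in> fst c \<and> openin (top_of_set (points M)) U \<and> p \<in> U \<and>
        (\<forall>x\<in>U \<inter> fst c. 0 \<le> laplace_beltrami M c w x) \<and>
        (snd c p $ bdry_coord = 0 \<longrightarrow>
          (\<exists>D N. (w \<circ> chart_inv c has_derivative D) (at (snd c p) within chart_image c) \<and>
            D N = 0 \<and> N $ bdry_coord < 0))"
    proof (cases "p \<in> boundary M")
      case True
      obtain c D N where c: "c \<in> charts M" "p \<in> fst c"
        and "(w \<circ> chart_inv c has_derivative D) (at (snd c p) within chart_image c)"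
          "D N = 0" "N $ bdry_coord < 0"
        using normal_deriv_eq_imp[OF u v True nd[OF True], of \<sigma>] unfolding w_def .
      then show ?thesis
        using p Lw0[OF c(1)] by (intro bexI[of _ c] exI[of _ "points M"]) auto
    next
      case False
      obtain c where c: "c \<in> charts M" "p \<in> fst c" using obtain_chart[OF p] .
      with False have "snd c p $ bdry_coord \<noteq> 0" by (auto simp: boundary_def)
      then show ?thesis
        using p c Lw0[OF c(1)] by (intro bexI[of _ c] exI[of _ "points M"]) auto
    qed
  qed
  show "\<exists>k. \<forall>x\<in>points M. u x - v x = k"
  proof (intro exI ballI)
    fix x assume "x \<in> points M"
    from const[OF this] have "\<sigma> * (u x - v x) = w p0" by (simp add: w_def algebra_simps)
    then show "u x - v x = \<sigma> * w p0" using \<sigma>2 by metis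
  qed
  have a0: "a x (u x) = 0" if x: "x \<in> points M" for x
  proof -
    obtain c where c: "c \<in> charts M" "x \<in> fst c" using obtain_chart[OF x] .
    \<comment> \<open>The Laplacian of a constant is 0, while that of \<open>w\<close> is
      \<open>\<sigma> * a x (u x)\<close>.\<close>
    have "laplace_beltrami M c (\<lambda>_. w p0) x = laplace_beltrami M c w x"
      using const by (intro laplace_beltrami_cong[OF w _ c]) simp
    then have "\<sigma> * a x (u x) = 0" using Lw[OF c] laplace_beltrami_const[OF c] by simp
    then show ?thesis using \<sigma> by auto
  qed
  have "K \<le> \<sigma> * u x" if "x \<in> points M" for x
  proof (rule minimum_principle[OF comp conn ne tu bd _ that])
    show "laplace_beltrami M c (\<lambda>x. \<sigma> * u x) x \<le> 0" if "c \<in> charts M" "x \<in> fst c" for c x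
      unfolding Ltu[OF that] using that chart_subset[OF that(1)] a0 by auto
  qed
  with a0 show "\<forall>x\<in>points M. a x (u x) = 0 \<and> K \<le> \<sigma> * u x" by blast
qed

text \<open>Gives meaning to \<open>deriv (a x)\<close>, so that its nonnegativity implies
  monotonicity. The whole line over a point lies in the product of the chart image with the reals,
  so the derivative in the real variable is two-sided even over boundary points.\<close>

lemma Ck_space_times_real_differentiable:
  assumes a: "a \<in> Ck_space_times_real M (Suc k)" and x: "x \<in> points M"
  shows "(a x has_real_derivative deriv (a x) s) (at s)"
proof -
  obtain c where c: "c \<in> charts M" "x \<in> fst c" using obtain_chart[OF x] .
  define A where "A = (\<lambda>(y, s). a (chart_inv c y) s)"
  have "Ck_on (Suc k) (chart_image c \<times> UNIV) A"
    using a c by (auto simp: Ck_space_times_real_def A_def)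
  then obtain A' where "\<forall>z\<in>chart_image c \<times> UNIV. (A has_derivative A' z) (at z within chart_image c \<times> UNIV)"
    unfolding Ck_on_def by auto
  then have "(A has_derivative A' (snd c x, s)) (at (snd c x, s) within chart_image c \<times> UNIV)"
    using c by blast
  then have "(A has_derivative A' (snd c x, s)) (at (snd c x, s) within range (Pair (snd c x)))"
    by (rule has_derivative_subset) (use c in auto)
  moreover have "(Pair (snd c x) has_derivative (\<lambda>t. (0, t))) (at s)"
    by (auto intro!: derivative_eq_intros)
  ultimately have "((\<lambda>t. A (snd c x, t)) has_derivative (\<lambda>t. A' (snd c x, s) (0, t))) (at s)"
    by (rule has_derivative_in_compose[rotated])
  moreover have "A (snd c x, t) = a x t" for t
    using chart_inv_image[OF c] by (simp add: A_def)
  ultimately have "a x differentiable (at s)" by (auto simp: differentiable_def)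
  then show ?thesis
    by (simp add: DERIV_deriv_iff_real_differentiable)
qed

end

lemma dn_map_eq_Some:
  assumes "dn_map M \<alpha> a f = Some \<psi>"
  obtains u where "dirichlet_solution M \<alpha> a f u" "\<psi> = restrict (normal_deriv M u) (boundary M)"
proof -
  have ex: "\<exists>!u. dirichlet_solution M \<alpha> a f u"
    using assms unfolding dn_map_def by (metis option.distinct(1))
  then show thesis
    using that[OF theI'[OF ex]] assms unfolding dn_map_def by simp
qed

theorem theorem2p1:
  fixes M :: "('a::t2_space, 'n::finite) riem"
    and \<alpha> c \<mu>\<^sub>1 :: real
    and a :: "'a \<Rightarrow> real \<Rightarrow> real"
    and f :: "'a \<Rightarrow> real"
    and h :: "real \<Rightarrow> 'a \<Rightarrow> real"
  assumes "riemannian_manifold_with_boundary M"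
    and "compact (points M)" and "connected (points M)" and "boundary M \<noteq> {}"
    and "CARD('n) \<ge> 2"
    and "\<alpha> \<in> {0<..<1}"
    and "a \<in> Ck_space_times_real M 2"
    and "\<And>x. x \<in> points M \<Longrightarrow> a x 0 = 0"
    and "\<And>x \<mu>. x \<in> points M \<Longrightarrow> deriv (a x) \<mu> \<ge> 0"
    and "f \<in> Holder_space_boundary M 2 \<alpha>"
    and "(INF x\<in>boundary M. f x) = c" and "c > 0"
    and "\<And>\<mu>. h \<mu> \<in> Holder_space_boundary M 2 \<alpha>"
    and "\<mu>\<^sub>1 > 0"
    and "\<And>\<mu>. \<mu> \<in> {-\<mu>\<^sub>1<..<\<mu>\<^sub>1} \<Longrightarrow>
           \<exists>\<psi>. dn_map M \<alpha> a (\<lambda>x. \<mu> * f x) = Some \<psi> \<and> dn_map M \<alpha> (\<lambda>x s. 0) (h \<mu>) = Some \<psi>"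
  shows "(\<forall>x\<in>points M. \<forall>\<mu>\<in>{-c * \<mu>\<^sub>1<..<c * \<mu>\<^sub>1}. a x \<mu> = 0) \<and>
         (\<forall>x\<^sub>0\<in>boundary M. \<forall>x\<in>boundary M. \<forall>\<mu>\<in>{-\<mu>\<^sub>1<..<\<mu>\<^sub>1}.
            h \<mu> x = h \<mu> x\<^sub>0 + \<mu> * (f x - f x\<^sub>0))"
proof -
  interpret riemannian_manifold_with_boundary M by fact
  have mono: "a x s \<le> a x t" if "x \<in> points M" "s \<le> t" for x s t
  proof (rule DERIV_nonneg_imp_nondecreasing[OF that(2)])
    show "\<exists>y. (a x has_real_derivative y) (at r) \<and> 0 \<le> y" for r
      using Ck_space_times_real_differentiable[of a 1 x r] assms(7) assms(9)[OF that(1), of r] that(1)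
      by (auto simp: numeral_2_eq_2)
  qed
  have sol: "\<exists>u v. dirichlet_solution M \<alpha> a (\<lambda>x. \<mu> * f x) u \<and> dirichlet_solution M \<alpha> (\<lambda>x s. 0) (h \<mu>) v \<and>
      (\<forall>p\<in>boundary M. normal_deriv M u p = normal_deriv M v p)" if \<mu>: "\<mu> \<in> {-\<mu>\<^sub>1<..<\<mu>\<^sub>1}" for \<mu>
  proof -
    obtain \<psi> where \<psi>: "dn_map M \<alpha> a (\<lambda>x. \<mu> * f x) = Some \<psi>" "dn_map M \<alpha> (\<lambda>x s. 0) (h \<mu>) = Some \<psi>"
      using assms(15)[OF \<mu>] by blast
    obtain u where u: "dirichlet_solution M \<alpha> a (\<lambda>x. \<mu> * f x) u" "\<psi> = restrict (normal_deriv M u) (boundary M)"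
      using dn_map_eq_Some[OF \<psi>(1)] .
    obtain v where v: "dirichlet_solution M \<alpha> (\<lambda>x s. 0) (h \<mu>) v" "\<psi> = restrict (normal_deriv M v) (boundary M)"
      using dn_map_eq_Some[OF \<psi>(2)] .
    have "normal_deriv M u p = normal_deriv M v p" if "p \<in> boundary M" for p
      using u(2) v(2) that by (metis restrict_apply')
    with u v show ?thesis by blast
  qed
  have fc: "c \<le> f x" if x: "x \<in> boundary M" for x
  proof -
    \<comment> \<open>The infimum is meaningful since \<open>f\<close> is the trace of a function continuous on the compact \<open>M\<close>.\<close>
    have "\<mu>\<^sub>1 / 2 \<in> {-\<mu>\<^sub>1<..<\<mu>\<^sub>1}" using assms(14) by simp
    from sol[OF this] obtain u where u: "dirichlet_solution M \<alpha> a (\<lambda>x. \<mu>\<^sub>1 / 2 * f x) u" by blast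
    have "compact (u ` points M)"
      by (intro compact_continuous_image twice_differentiable_continuous_on assms(2) dirichlet_solutionD(1)[OF u])
    then have "bdd_below (u ` points M)"
      by (intro bounded_imp_bdd_below compact_imp_bounded)
    then obtain B where B: "\<And>y. y \<in> points M \<Longrightarrow> B \<le> u y" by (auto simp: bdd_below_def)
    have "B / (\<mu>\<^sub>1 / 2) \<le> f y" if "y \<in> boundary M" for y
    proof -
      have "B \<le> \<mu>\<^sub>1 / 2 * f y"
        using B[of y] dirichlet_solutionD(3)[OF u that] boundary_subset that by auto
      then show ?thesis using assms(14) by (simp add: field_simps)
    qed
    then have "bdd_below (f ` boundary M)" by (auto simp: bdd_below_def)
    then show ?thesis using assms(11) x by (metis cINF_lower)
  qed
  \<comment> \<open>At \<mu> = 0 either sign would do, as the boundary data and the bound are then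
    0; the value 1 is a convention.\<close>
  have key: "(\<exists>k. \<forall>x\<in>boundary M. \<mu> * f x - h \<mu> x = k) \<and> (\<exists>u. \<forall>x\<in>points M. a x (u x) = 0 \<and> \<bar>\<mu>\<bar> * c \<le> \<sigma> * u x)"
    if \<mu>: "\<mu> \<in> {-\<mu>\<^sub>1<..<\<mu>\<^sub>1}" and \<sigma>: "\<sigma> = (if 0 \<le> \<mu> then 1 else - 1)" for \<mu> \<sigma>
  proof -
    obtain u v where u: "dirichlet_solution M \<alpha> a (\<lambda>x. \<mu> * f x) u"
      and v: "dirichlet_solution M \<alpha> (\<lambda>x s. 0) (h \<mu>) v"
      and nd: "\<And>p. p \<in> boundary M \<Longrightarrow> normal_deriv M u p = normal_deriv M v p"
      using sol[OF \<mu>] by blast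
    have "\<bar>\<mu>\<bar> * c \<le> \<sigma> * u x" if "x \<in> boundary M" for x
    proof -
      have "\<bar>\<mu>\<bar> * c \<le> \<bar>\<mu>\<bar> * f x" using fc[OF that] by (intro mult_left_mono) auto
      also have "\<dots> = \<sigma> * u x" using dirichlet_solutionD(3)[OF u that] \<sigma> by simp
      finally show ?thesis .
    qed
    note R = same_normal_derivative_rigidity[where a = a and \<sigma> = \<sigma>, OF assms(2-4) _ mono assms(8) dirichlet_solutionD(1)[OF u]
        dirichlet_solutionD(1)[OF v] dirichlet_solutionD(2)[OF u] dirichlet_solutionD(2)[OF v] nd this]
    obtain k where "\<forall>x\<in>points M. u x - v x = k"
      using R(1) \<sigma> assms(12) by (auto split: if_splits)
    then have "\<forall>x\<in>boundary M. \<mu> * f x - h \<mu> x = k"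
      using dirichlet_solutionD(3)[OF u] dirichlet_solutionD(3)[OF v] subsetD[OF boundary_subset] by metis
    moreover have "\<forall>x\<in>points M. a x (u x) = 0 \<and> \<bar>\<mu>\<bar> * c \<le> \<sigma> * u x"
      using R(2) \<sigma> assms(12) by (auto split: if_splits)
    ultimately show ?thesis by blast
  qed
  show ?thesis
  proof (intro conjI ballI)
    fix x s assume x: "x \<in> points M" and s: "s \<in> {-c * \<mu>\<^sub>1<..<c * \<mu>\<^sub>1}"
    \<comment> \<open>With this parameter the lower bound \<open>\<bar>\<mu>\<bar> * c\<close> is
      exactly the modulus of \<open>s\<close>, so \<open>s\<close> lies between 0 and
      \<open>u x\<close>, two zeros of the nondecreasing function \<open>a x\<close>.\<close>
    define \<mu> where "\<mu> = s / c"
    have "\<mu> \<in> {-\<mu>\<^sub>1<..<\<mu>\<^sub>1}" using s assms(12) by (auto simp: \<mu>_def field_simps)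
    from key[OF this refl] obtain u where u: "\<And>x. x \<in> points M \<Longrightarrow>
        a x (u x) = 0 \<and> \<bar>\<mu>\<bar> * c \<le> (if 0 \<le> \<mu> then 1 else - 1) * u x" by blast
    have \<mu>c: "\<bar>\<mu>\<bar> * c = \<bar>s\<bar>" using assms(12) by (simp add: \<mu>_def abs_mult[symmetric])
    show "a x s = 0"
    proof (cases "0 \<le> \<mu>")
      case True
      then have "0 \<le> s" using assms(12) by (simp add: \<mu>_def zero_le_divide_iff)
      with True u[OF x] \<mu>c have "0 \<le> s" "s \<le> u x" by auto
      from this[THEN mono[OF x]]
      show ?thesis using u[OF x] assms(8)[OF x] by simp
    next
      case False
      then have "s \<le> 0" using assms(12) by (simp add: \<mu>_def zero_le_divide_iff)
      with False u[OF x] \<mu>c have "s \<le> 0" "u x \<le> s" by auto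
      from this[THEN mono[OF x]]
      show ?thesis using u[OF x] assms(8)[OF x] by simp
    qed
  next
    fix x\<^sub>0 x \<mu> assume "x\<^sub>0 \<in> boundary M" "x \<in> boundary M" and \<mu>: "\<mu> \<in> {-\<mu>\<^sub>1<..<\<mu>\<^sub>1}"
    moreover from key[OF \<mu> refl] obtain k where "\<And>x. x \<in> boundary M \<Longrightarrow> \<mu> * f x - h \<mu> x = k" by blast
    ultimately have "\<mu> * f x - h \<mu> x = \<mu> * f x\<^sub>0 - h \<mu> x\<^sub>0" by simp
    then show "h \<mu> x = h \<mu> x\<^sub>0 + \<mu> * (f x - f x\<^sub>0)" by (simp add: algebra_simps)
  qed
qed

end
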